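(* Let the setting and notation be those described in the context. Assume that the projected stationary hydrostatic solutions satisfy $$\rho_h^e(x)>0,\qquad p_h^e(x)>0,\qquad\forall x\in\mathbb S_j,\ \forall j,$$ and that the numerical solution ${\bf U}_h\in[\mathbb V_h^k]^3$ satisfies $${\bf U}_h(x)\in G,\qquad\forall x\in\mathbb S_j,\ \forall j.$$ Then $$\overline{\bf U}_j+\Delta t\,{\bf L}_j({\bf U}_h)\in G,\qquad\forall j,$$ under the CFL-type condition $$\widetilde\alpha_j\,\Delta t\le\widehat\omega_1h_j\qquad\forall j.$$
   Context: **States.** Fix $\gamma>1$. States are ${\bf U}=(\rho,m,E)^\top\in\mathbb R^3$ with $u=m/\rho$, $e=\frac1\rho\big(E-\frac{m^2}{2\rho}\big)$, $p=(\gamma-1)\rho e$; ${\bf F}({\bf U})=(\rho u,\rho u^2+p,(E+p)u)^\top$; $G=\{(\rho,m,E)^\top:\rho>0,\ E-\frac{m^2}{2\rho}>0\}$; $\alpha_\pm({\bf U})=u\pm\sqrt{\gamma p/\rho}$, $\alpha_{\max}({\bf U})=|u|+\sqrt{\gamma p/\rho}$. **HLLC flux.** For ${\bf U}_L,{\bf U}_R\in G$, let $S_L=\min\{\alpha_-({\bf U}_L),\alpha_-({\bf U}_R)\}$, $S_R=\max\{\alpha_+({\bf U}_L),\alpha_+({\bf U}_R)\}$, $$S_*=\frac{p_R-p_L+\rho_Lu_L(S_L-u_L)-\rho_Ru_R(S_R-u_R)}{\rho_L(S_L-u_L)-\rho_R(S_R-u_R)},$$ and for $i\in\{L,R\}$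 $${\bf U}_{*i}=\rho_i\frac{S_i-u_i}{S_i-S_*}\Big(1,\ S_*,\ \frac{E_i}{\rho_i}+(S_*-u_i)\Big(S_*+\frac{p_i}{\rho_i(S_i-u_i)}\Big)\Big)^\top,\qquad {\bf F}_{*i}={\bf F}({\bf U}_i)+S_i({\bf U}_{*i}-{\bf U}_i).$$ Then ${\bf F}^{hllc}({\bf U}_L,{\bf U}_R)$ equals ${\bf F}({\bf U}_L)$ if $0\le S_L$; ${\bf F}_{*L}$ if $S_L\le0\le S_*$; ${\bf F}_{*R}$ if $S_*\le0\le S_R$; ${\bf F}({\bf U}_R)$ if $0\ge S_R$. **Mesh and spaces.** The domain is divided into cells $I_j=(x_{j-\frac12},x_{j+\frac12})$, $h_j=x_{j+\frac12}-x_{j-\frac12}$. $\mathbb V_h^k$ is the space of $L^2$ functions that are polynomials of degree at most $k$ on each $I_j$ (here $k\ge1$). ${\bf U}_h=(\rho_h,m_h,E_h)^\top\in[\mathbb V_h^k]^3$; ${\bf U}_{j+\frac12}^\pm={\bf U}_h(x_{j+\frac12}^\pm)$ (right/left limits). On each $\mathbb S_j$, functions are evaluated using their polynomial on $I_j$ (i.e. by interior limits at cell endpoints). $\overline{\bf U}_j=(\overline\rho_j,\overline m_j,\overline E_j)^\top$ is the cell average of ${\bf U}_h$ over $I_j$, and $\overline e_j=\frac1{\overline\rho_j}\big(\overline E_j-\frac{\overline m_j^2}{2\overline\rho_j}\big)$; $e_h(x)$ is the value of $e$ at ${\bf U}_h(x)$. $\rho_h^e,p_h^e\in\mathbb V_h^k$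 are the projections of the density and pressure $\rho^e(x),p^e(x)$ of a given stationary hydrostatic solution, $(p^e)_x=-\rho^e\phi_x$ with $\phi$ the static gravitational potential, and zero velocity; $\overline\rho_j^e$ is the cell average of $\rho_h^e$ over $I_j$; $[\![p_h^e]\!]_{j+\frac12}=p_h^e(x_{j+\frac12}^+)-p_h^e(x_{j+\frac12}^-)$. Each cell has two neighbours; at the domain boundary the exterior (ghost) values are those supplied by boundary conditions and satisfy the same hypotheses. **Quadratures.** $\{x_j^{(\mu)},\omega_\mu\}_{\mu=1}^N$ are the $N$-point Gauss nodes and weights in $I_j$, normalized so that $\sum\omega_\mu=1$, with $N$ large enough that the rule is exact for polynomials of degree $\le k$. $\{\widehat x_j^{(\nu)}\}_{\nu=1}^L$ are the $L$-point Gauss–Lobatto nodes in $I_j$ with weights $\widehat\omega_\nu$, $\sum\widehat\omega_\nu=1$, $\widehat\omega_1=\widehat\omega_L=\frac1{L(L-1)}$, $L\ge(k+3)/2$. $\mathbb S_j=\{\widehat x_j^{(\nu)}\}_{\nu=1}^L\cup\{x_j^{(\mu)}\}_{\mu=1}^N$. **Cell-average operator of the DG scheme.** $p^{e,\star}_{j+\frac12}=\frac12\big(p_h^e(x_{j+\frac12}^-)+p_h^e(x_{j+\frac12}^+)\big)$, $$\widehat{\bf F}_{j+\frac12}={\bf F}^{hllc}\Big(\frac{p^{e,\star}_{j+\frac12}}{p_h^e(x_{j+\frac12}^-)}{\bf U}_{j+\frac12}^-,\ \frac{p^{e,\star}_{j+\frac12}}{p_h^e(x_{j+\frac12}^+)}{\bf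 U}_{j+\frac12}^+\Big),$$ ${\bf L}_j({\bf U}_h)=-\frac1{h_j}\big(\widehat{\bf F}_{j+\frac12}-\widehat{\bf F}_{j-\frac12}\big)+\big(0,\overline S_j^{[2]},\overline S_j^{[3]}\big)^\top$, where $$\overline S_j^{[2]}=\sum_{\mu=1}^N\omega_\mu\Big(\frac{\rho_h(x_j^{(\mu)})}{\rho_h^e(x_j^{(\mu)})}-\frac{\overline\rho_j}{\overline\rho_j^e}\Big)(p_h^e)_x(x_j^{(\mu)})+\frac{\overline\rho_j}{\overline\rho_j^e}\,\frac{p^{e,\star}_{j+\frac12}-p^{e,\star}_{j-\frac12}}{h_j},$$ $$\overline S_j^{[3]}=\sum_{\mu=1}^N\omega_\mu\Big(\frac{m_h(x_j^{(\mu)})}{\rho_h^e(x_j^{(\mu)})}-\frac{\overline m_j}{\overline\rho_j^e}\Big)(p_h^e)_x(x_j^{(\mu)})+\frac{\overline m_j}{\overline\rho_j^e}\,\frac{p^{e,\star}_{j+\frac12}-p^{e,\star}_{j-\frac12}}{h_j}.$$ $\Delta t>0$ is the time step. **CFL quantity.** $\widetilde\alpha_j=\widetilde\alpha_j^F+\widetilde\alpha_j^S+\overline\alpha_j^S$ with $$\widetilde\alpha_j^F=2\max\Big\{\frac{p^{e,\star}_{j+\frac12}}{p_h^e(x_{j+\frac12}^-)},\frac{p^{e,\star}_{j-\frac12}}{p_h^e(x_{j-\frac12}^+)}\Big\}\max_{{\bf U}\in\{{\bf U}_{j-\frac12}^\pm,{\bf U}_{j+\frac12}^\pm\}}\alpha_{\max}({\bf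 U}),$$ $$\widetilde\alpha_j^S=\widehat\omega_1h_j\max_{1\le\mu\le N}\frac{|(p_h^e)_x(x_j^{(\mu)})|}{\rho_h^e(x_j^{(\mu)})\sqrt{2e_h(x_j^{(\mu)})}},\qquad \overline\alpha_j^S=\widehat\omega_1\frac{\big|[\![p_h^e]\!]_{j+\frac12}+[\![p_h^e]\!]_{j-\frac12}\big|}{2\overline\rho_j^e\sqrt{2\overline e_j}}.$$ *)

theory Defs
  imports "HOL-Analysis.Analysis" "HOL-Computational_Algebra.Polynomial"
begin

section \<open>Euler states and the HLLC flux\<close>

text \<open>A state is the vector \<open>(\<rho>, m, E)\<close>, with components \<open>U $ 1\<close>, \<open>U $ 2\<close>, \<open>U $ 3\<close>.\<close>

definition velocity :: "real ^ 3 \<Rightarrow> real" where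
  "velocity U = U $ 2 / U $ 1"

definition internal_energy :: "real ^ 3 \<Rightarrow> real" where
  "internal_energy U = 1 / U $ 1 * (U $ 3 - (U $ 2)\<^sup>2 / (2 * U $ 1))"

definition pressure :: "real \<Rightarrow> real ^ 3 \<Rightarrow> real" where
  "pressure \<gamma> U = (\<gamma> - 1) * U $ 1 * internal_energy U"

definition euler_flux :: "real \<Rightarrow> real ^ 3 \<Rightarrow> real ^ 3" where
  "euler_flux \<gamma> U = vector
     [U $ 1 * velocity U,
      U $ 1 * (velocity U)\<^sup>2 + pressure \<gamma> U,
      (U $ 3 + pressure \<gamma> U) * velocity U]"

definition admissible :: "(real ^ 3) set" where
  "admissible = {U. U $ 1 > 0 \<and> U $ 3 - (U $ 2)\<^sup>2 / (2 * U $ 1) > 0}"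

definition sound_speed :: "real \<Rightarrow> real ^ 3 \<Rightarrow> real" where
  "sound_speed \<gamma> U = sqrt (\<gamma> * pressure \<gamma> U / U $ 1)"

definition alpha_minus :: "real \<Rightarrow> real ^ 3 \<Rightarrow> real" where
  "alpha_minus \<gamma> U = velocity U - sound_speed \<gamma> U"

definition alpha_plus :: "real \<Rightarrow> real ^ 3 \<Rightarrow> real" where
  "alpha_plus \<gamma> U = velocity U + sound_speed \<gamma> U"

definition alpha_max :: "real \<Rightarrow> real ^ 3 \<Rightarrow> real" where
  "alpha_max \<gamma> U = \<bar>velocity U\<bar> + sound_speed \<gamma> U"

definition speed_L :: "real \<Rightarrow> real ^ 3 \<Rightarrow> real ^ 3 \<Rightarrow> real" where
  "speed_L \<gamma> UL UR = min (alpha_minus \<gamma> UL) (alpha_minus \<gamma> UR)"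

definition speed_R :: "real \<Rightarrow> real ^ 3 \<Rightarrow> real ^ 3 \<Rightarrow> real" where
  "speed_R \<gamma> UL UR = max (alpha_plus \<gamma> UL) (alpha_plus \<gamma> UR)"

definition speed_star :: "real \<Rightarrow> real ^ 3 \<Rightarrow> real ^ 3 \<Rightarrow> real" where
  "speed_star \<gamma> UL UR =
     (let SL = speed_L \<gamma> UL UR; SR = speed_R \<gamma> UL UR; uL = velocity UL; uR = velocity UR in
      (pressure \<gamma> UR - pressure \<gamma> UL + UL $ 1 * uL * (SL - uL) - UR $ 1 * uR * (SR - uR))
      / (UL $ 1 * (SL - uL) - UR $ 1 * (SR - uR)))"

definition star_state :: "real \<Rightarrow> real \<Rightarrow> real \<Rightarrow> real ^ 3 \<Rightarrow> real ^ 3" where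
  "star_state \<gamma> S Sstar U =
     (let \<rho> = U $ 1; u = velocity U in
      (\<rho> * ((S - u) / (S - Sstar))) *\<^sub>R vector
        [1, Sstar, U $ 3 / \<rho> + (Sstar - u) * (Sstar + pressure \<gamma> U / (\<rho> * (S - u)))])"

definition star_flux :: "real \<Rightarrow> real \<Rightarrow> real \<Rightarrow> real ^ 3 \<Rightarrow> real ^ 3" where
  "star_flux \<gamma> S Sstar U = euler_flux \<gamma> U + S *\<^sub>R (star_state \<gamma> S Sstar U - U)"

text \<open>For admissible states \<open>S\<^sub>L < S\<^sub>* < S\<^sub>R\<close>, and neighbouring branches agree where their
  conditions overlap (\<open>S\<^sub>L = 0\<close>, \<open>S\<^sub>* = 0\<close> or \<open>S\<^sub>R = 0\<close>), so the order of the case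
  distinction is immaterial.\<close>

definition hllc_flux :: "real \<Rightarrow> real ^ 3 \<Rightarrow> real ^ 3 \<Rightarrow> real ^ 3" where
  "hllc_flux \<gamma> UL UR =
     (let SL = speed_L \<gamma> UL UR; SR = speed_R \<gamma> UL UR; Sstar = speed_star \<gamma> UL UR in
      if 0 \<le> SL then euler_flux \<gamma> UL
      else if 0 \<le> Sstar then star_flux \<gamma> SL Sstar UL
      else if 0 \<le> SR then star_flux \<gamma> SR Sstar UR
      else euler_flux \<gamma> UR)"


section \<open>Mesh and piecewise polynomials\<close>

text \<open>The mesh has cells \<open>1, \<dots>, M\<close>.  It is given by \<open>x :: nat \<Rightarrow> real\<close>, where \<open>x j\<close> is
  the cell interface \<open>x\<^bsub>j+1/2\<^esub>\<close>, so cell \<open>j\<close> is the interval between \<open>x (j - 1)\<close>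
  and \<open>x j\<close>.

  A piecewise polynomial is represented by the family of its polynomials on the cells, in
  the global coordinate; one-sided limits at interfaces are then values of the polynomial of
  the respective cell.  The indices \<open>0\<close> and \<open>M + 1\<close> stand for the ghost cells: the scheme
  only uses the values of these two polynomials at \<open>x 0\<close> and \<open>x M\<close>, which are the exterior
  values supplied by the boundary conditions.\<close>

definition mesh :: "nat \<Rightarrow> (nat \<Rightarrow> real) \<Rightarrow> bool" where
  "mesh M x \<longleftrightarrow> (\<forall>j\<in>{1..M}. x (j - 1) < x j)"

definition cell_size :: "(nat \<Rightarrow> real) \<Rightarrow> nat \<Rightarrow> real" where
  "cell_size x j = x j - x (j - 1)"

definition Vh :: "nat \<Rightarrow> nat \<Rightarrow> (nat \<Rightarrow> real poly) set" where
  "Vh M k = {f. \<forall>j\<in>{1..M}. degree (f j) \<le> k}"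

definition cell_average :: "(nat \<Rightarrow> real) \<Rightarrow> (nat \<Rightarrow> real poly) \<Rightarrow> nat \<Rightarrow> real" where
  "cell_average x f j = 1 / cell_size x j * integral {x (j - 1)..x j} (poly (f j))"

definition state_at :: "(nat \<Rightarrow> real poly ^ 3) \<Rightarrow> nat \<Rightarrow> real \<Rightarrow> real ^ 3" where
  "state_at U j y = (\<chi> i. poly (U j $ i) y)"

definition state_average :: "(nat \<Rightarrow> real) \<Rightarrow> (nat \<Rightarrow> real poly ^ 3) \<Rightarrow> nat \<Rightarrow> real ^ 3" where
  "state_average x U j = (\<chi> i. cell_average x (\<lambda>j. U j $ i) j)"


section \<open>Quadrature rules\<close>

text \<open>Rules are given on the reference interval \<open>[-1, 1]\<close>, with nodes and weights indexed
  from 1 and weights normalized to sum 1 (exactness for constants); they integrate the mean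
  value.\<close>

definition quad_exact :: "nat \<Rightarrow> (nat \<Rightarrow> real) \<Rightarrow> (nat \<Rightarrow> real) \<Rightarrow> nat \<Rightarrow> bool" where
  "quad_exact n \<xi> w d \<longleftrightarrow>
     (\<forall>p :: real poly. degree p \<le> d \<longrightarrow>
        (\<Sum>i = 1..n. w i * poly p (\<xi> i)) = integral {-1..1} (poly p) / 2)"

definition gauss_rule :: "nat \<Rightarrow> (nat \<Rightarrow> real) \<Rightarrow> (nat \<Rightarrow> real) \<Rightarrow> bool" where
  "gauss_rule n \<xi> w \<longleftrightarrow>
     n \<ge> 1 \<and> strict_mono_on {1..n} \<xi> \<and> (\<forall>i\<in>{1..n}. -1 < \<xi> i \<and> \<xi> i < 1) \<and>
     quad_exact n \<xi> w (2 * n - 1)"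

text \<open>These conditions determine the nodes and weights uniquely; in particular
  \<open>w 1 = w n = 1 / (n (n - 1))\<close>.\<close>

definition gauss_lobatto_rule :: "nat \<Rightarrow> (nat \<Rightarrow> real) \<Rightarrow> (nat \<Rightarrow> real) \<Rightarrow> bool" where
  "gauss_lobatto_rule n \<xi> w \<longleftrightarrow>
     n \<ge> 2 \<and> strict_mono_on {1..n} \<xi> \<and> \<xi> 1 = -1 \<and> \<xi> n = 1 \<and>
     quad_exact n \<xi> w (2 * n - 3)"

definition cell_node :: "(nat \<Rightarrow> real) \<Rightarrow> (nat \<Rightarrow> real) \<Rightarrow> nat \<Rightarrow> nat \<Rightarrow> real" where
  "cell_node x \<xi> j i = (x (j - 1) + x j) / 2 + cell_size x j / 2 * \<xi> i"

text \<open>The set \<open>S\<^sub>j\<close> of all Gauss--Lobatto and Gauss nodes in cell \<open>j\<close>.\<close>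

definition cell_points ::
  "(nat \<Rightarrow> real) \<Rightarrow> nat \<Rightarrow> (nat \<Rightarrow> real) \<Rightarrow> nat \<Rightarrow> (nat \<Rightarrow> real) \<Rightarrow> nat \<Rightarrow> real set" where
  "cell_points x L \<xi>' N \<xi> j = cell_node x \<xi>' j ` {1..L} \<union> cell_node x \<xi> j ` {1..N}"


section \<open>Stationary hydrostatic solution\<close>

definition hydrostatic ::
  "real set \<Rightarrow> (real \<Rightarrow> real) \<Rightarrow> (real \<Rightarrow> real) \<Rightarrow> (real \<Rightarrow> real) \<Rightarrow> (real \<Rightarrow> real) \<Rightarrow> bool" where
  "hydrostatic D \<phi> \<rho> u p \<longleftrightarrow>
     (\<forall>y\<in>D. u y = 0 \<and> \<phi> field_differentiable (at y) \<and>
        (p has_real_derivative - \<rho> y * deriv \<phi> y) (at y))"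

text \<open>A linear projection onto the piecewise polynomials: an operator on a space \<open>W\<close> of
  functions that reproduces every piecewise polynomial of degree at most \<open>k\<close>.  An example is
  the \<open>L\<^sup>2\<close> projection, with \<open>W\<close> the functions that are square integrable on every cell.\<close>

definition Vh_projection ::
  "nat \<Rightarrow> (nat \<Rightarrow> real) \<Rightarrow> nat \<Rightarrow> (real \<Rightarrow> real) set
     \<Rightarrow> ((real \<Rightarrow> real) \<Rightarrow> nat \<Rightarrow> real poly) \<Rightarrow> bool" where
  "Vh_projection M x k W P \<longleftrightarrow>
     (\<forall>f\<in>W. P f \<in> Vh M k) \<and>
     (\<forall>f\<in>W. \<forall>g\<in>W. \<forall>a b. (\<lambda>y. a * f y + b * g y) \<in> W \<and>
        (\<forall>j\<in>{1..M}. P (\<lambda>y. a * f y + b * g y) j = smult a (P f j) + smult b (P g j))) \<and>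
     (\<forall>f. \<forall>g\<in>Vh M k.
        (\<forall>j\<in>{1..M}. \<forall>y\<in>{x (j - 1)<..<x j}. f y = poly (g j) y) \<longrightarrow>
        f \<in> W \<and> (\<forall>j\<in>{1..M}. P f j = g j))"


section \<open>Cell averages of the discontinuous Galerkin scheme\<close>

text \<open>\<open>pe\<close> and \<open>\<rho>e\<close> are the projected hydrostatic pressure and density.\<close>

definition p_star :: "(nat \<Rightarrow> real) \<Rightarrow> (nat \<Rightarrow> real poly) \<Rightarrow> nat \<Rightarrow> real" where
  "p_star x pe j = 1 / 2 * (poly (pe j) (x j) + poly (pe (j + 1)) (x j))"

definition p_jump :: "(nat \<Rightarrow> real) \<Rightarrow> (nat \<Rightarrow> real poly) \<Rightarrow> nat \<Rightarrow> real" where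
  "p_jump x pe j = poly (pe (j + 1)) (x j) - poly (pe j) (x j)"

definition numerical_flux ::
  "real \<Rightarrow> (nat \<Rightarrow> real) \<Rightarrow> (nat \<Rightarrow> real poly) \<Rightarrow> (nat \<Rightarrow> real poly ^ 3) \<Rightarrow> nat \<Rightarrow> real ^ 3" where
  "numerical_flux \<gamma> x pe U j = hllc_flux \<gamma>
     ((p_star x pe j / poly (pe j) (x j)) *\<^sub>R state_at U j (x j))
     ((p_star x pe j / poly (pe (j + 1)) (x j)) *\<^sub>R state_at U (j + 1) (x j))"

text \<open>The momentum and energy sources are the same functional applied to \<open>w = \<rho>\<^sub>h\<close> and
  \<open>w = m\<^sub>h\<close> respectively.\<close>

definition source ::
  "(nat \<Rightarrow> real) \<Rightarrow> nat \<Rightarrow> (nat \<Rightarrow> real) \<Rightarrow> (nat \<Rightarrow> real) \<Rightarrow> (nat \<Rightarrow> real poly)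
     \<Rightarrow> (nat \<Rightarrow> real poly) \<Rightarrow> (nat \<Rightarrow> real poly) \<Rightarrow> nat \<Rightarrow> real" where
  "source x N \<xi> \<omega> \<rho>e pe w j =
     (\<Sum>\<mu> = 1..N. \<omega> \<mu> *
        (poly (w j) (cell_node x \<xi> j \<mu>) / poly (\<rho>e j) (cell_node x \<xi> j \<mu>)
           - cell_average x w j / cell_average x \<rho>e j)
        * poly (pderiv (pe j)) (cell_node x \<xi> j \<mu>))
     + cell_average x w j / cell_average x \<rho>e j
        * ((p_star x pe j - p_star x pe (j - 1)) / cell_size x j)"

definition dg_operator ::
  "real \<Rightarrow> (nat \<Rightarrow> real) \<Rightarrow> nat \<Rightarrow> (nat \<Rightarrow> real) \<Rightarrow> (nat \<Rightarrow> real) \<Rightarrow> (nat \<Rightarrow> real poly)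
     \<Rightarrow> (nat \<Rightarrow> real poly) \<Rightarrow> (nat \<Rightarrow> real poly ^ 3) \<Rightarrow> nat \<Rightarrow> real ^ 3" where
  "dg_operator \<gamma> x N \<xi> \<omega> \<rho>e pe U j =
     - (1 / cell_size x j) *\<^sub>R (numerical_flux \<gamma> x pe U j - numerical_flux \<gamma> x pe U (j - 1))
     + vector [0,
         source x N \<xi> \<omega> \<rho>e pe (\<lambda>j. U j $ 1) j,
         source x N \<xi> \<omega> \<rho>e pe (\<lambda>j. U j $ 2) j]"


section \<open>The CFL quantity\<close>

text \<open>Below, \<open>\<omega>1\<close> is the weight of the first Gauss--Lobatto node.\<close>

definition cfl_flux ::
  "real \<Rightarrow> (nat \<Rightarrow> real) \<Rightarrow> (nat \<Rightarrow> real poly) \<Rightarrow> (nat \<Rightarrow> real poly ^ 3) \<Rightarrow> nat \<Rightarrow> real" where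
  "cfl_flux \<gamma> x pe U j =
     2 * max (p_star x pe j / poly (pe j) (x j))
             (p_star x pe (j - 1) / poly (pe j) (x (j - 1)))
       * Max (alpha_max \<gamma> `
           {state_at U (j - 1) (x (j - 1)), state_at U j (x (j - 1)),
            state_at U j (x j), state_at U (j + 1) (x j)})"

definition cfl_source ::
  "(nat \<Rightarrow> real) \<Rightarrow> nat \<Rightarrow> (nat \<Rightarrow> real) \<Rightarrow> real \<Rightarrow> (nat \<Rightarrow> real poly)
     \<Rightarrow> (nat \<Rightarrow> real poly) \<Rightarrow> (nat \<Rightarrow> real poly ^ 3) \<Rightarrow> nat \<Rightarrow> real" where
  "cfl_source x N \<xi> \<omega>1 \<rho>e pe U j =
     \<omega>1 * cell_size x j *
     Max ((\<lambda>\<mu>. \<bar>poly (pderiv (pe j)) (cell_node x \<xi> j \<mu>)\<bar>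
        / (poly (\<rho>e j) (cell_node x \<xi> j \<mu>)
           * sqrt (2 * internal_energy (state_at U j (cell_node x \<xi> j \<mu>))))) ` {1..N})"

definition cfl_source_average ::
  "(nat \<Rightarrow> real) \<Rightarrow> real \<Rightarrow> (nat \<Rightarrow> real poly) \<Rightarrow> (nat \<Rightarrow> real poly)
     \<Rightarrow> (nat \<Rightarrow> real poly ^ 3) \<Rightarrow> nat \<Rightarrow> real" where
  "cfl_source_average x \<omega>1 \<rho>e pe U j =
     \<omega>1 * (\<bar>p_jump x pe j + p_jump x pe (j - 1)\<bar>
       / (2 * cell_average x \<rho>e j * sqrt (2 * internal_energy (state_average x U j))))"

definition cfl_alpha ::
  "real \<Rightarrow> (nat \<Rightarrow> real) \<Rightarrow> nat \<Rightarrow> (nat \<Rightarrow> real) \<Rightarrow> real \<Rightarrow> (nat \<Rightarrow> real poly)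
     \<Rightarrow> (nat \<Rightarrow> real poly) \<Rightarrow> (nat \<Rightarrow> real poly ^ 3) \<Rightarrow> nat \<Rightarrow> real" where
  "cfl_alpha \<gamma> x N \<xi> \<omega>1 \<rho>e pe U j =
     cfl_flux \<gamma> x pe U j + cfl_source x N \<xi> \<omega>1 \<rho>e pe U j + cfl_source_average x \<omega>1 \<rho>e pe U j"

end

theory Submission
  imports Defs
begin

text \<open>The admissible states form an open convex cone \<open>G\<close>.  Let \<open>K\<close> be the closed convex
  cone cut out by the same inequalities in their non-strict form.  Both are closed under addition and
  under multiplication by positive numbers, and \<open>G + K\<close> lies in \<open>G\<close>.  The proof writes the
  updated average as a sum of elements of \<open>K\<close>, at least one of which lies in \<open>G\<close>.

  Multiplied by the size \<open>h\<close> of the cell, the update of the cell average \<open>V\<close> is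
  \<open>h V - \<Delta>t (F\<^sub>r - F\<^sub>l) + \<Delta>t S\<close>, where \<open>F\<^sub>l\<close>, \<open>F\<^sub>r\<close> are the
  numerical fluxes at the ends of the cell and \<open>S\<close> is \<open>h\<close> times the source.
  The CFL condition says that \<open>h V\<close> is enough to supply three shares of \<open>V\<close>, each of size
  \<open>\<Delta>t / \<omega>\<^sub>1\<close> times one of the three summands of the CFL quantity.  What is left over is a
  nonnegative multiple of \<open>V\<close>, hence in \<open>K\<close>.

  The first share pays for the fluxes.  The Gauss--Lobatto rule gives \<open>V\<close> as
  \<open>\<omega>\<^sub>1\<close> times the sum of the two end states plus an element of \<open>K\<close>, so at each end it
  suffices that \<open>2 \<alpha> U - F\<close> (right end) and \<open>2 \<alpha> U + F\<close> (left end) lie in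
  \<open>G\<close> (\<open>hllc_flux_one_sided\<close>).  One \<open>\<alpha> U\<close> absorbs the exact flux \<open>F(U)\<close>
  (\<open>lax_friedrichs_splitting\<close>).  The other absorbs the difference between the numerical and the
  exact flux: \<open>\<alpha> U\<close> plus this difference, with the sign of its side, is the integral of
  the approximate Riemann solution over one side of the fan, thus a combination of the end states and the two star states
  with nonnegative weights (\<open>hllc_flux_fan\<close>).  The scaling of the traces by ratios of
  pressures changes neither velocity nor sound speed, so it only rescales the required multiple.

  The other two shares pay for the source.  Because the Gauss rule integrates \<open>p\<^sub>x\<close> exactly,
  the source splits into forces \<open>(0, \<beta> \<rho>, \<beta> m)\<close> at the Gauss nodes and one such force on
  \<open>V\<close> whose \<open>\<beta>\<close> comes from the jumps of the projected pressure (\<open>source_vector\<close>).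
  A force tilts the state without leaving \<open>K\<close> as long as \<open>\<bar>\<beta>\<bar>\<close> is at most \<open>\<surd>(2 e)\<close>
  times the multiple of the state that it acts on (\<open>forcing_closed_cone\<close>).\<close>

section \<open>The cone of admissible states\<close>

text \<open>Clearing the denominator turns the energy condition into a quadratic form, which is what makes
  convexity an instance of the reversed Cauchy--Schwarz inequality.\<close>

lemma admissible_iff:
  "U \<in> admissible \<longleftrightarrow> U $ 1 > 0 \<and> (U $ 2)\<^sup>2 < 2 * U $ 1 * U $ 3"
  unfolding admissible_def by (auto simp: field_simps)

text \<open>This is the closure of \<open>admissible\<close>; the sign of the energy has to be required here, since
  at density zero the quadratic inequality does not imply it.\<close>

definition closed_cone :: "(real ^ 3) set" where
  "closed_cone = {U. U $ 1 \<ge> 0 \<and> U $ 3 \<ge> 0 \<and> (U $ 2)\<^sup>2 \<le> 2 * U $ 1 * U $ 3}"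

lemma energy_pos: "U \<in> admissible \<Longrightarrow> U $ 3 > 0"
  unfolding admissible_iff
  by (smt (verit) zero_le_power2 mult_nonneg_nonpos)

lemma admissible_imp_closed_cone: "U \<in> admissible \<Longrightarrow> U \<in> closed_cone"
  using energy_pos[of U] by (auto simp: closed_cone_def admissible_iff)

text \<open>The reversed Cauchy--Schwarz inequality for the form \<open>2 \<rho> E - m\<^sup>2\<close>: its mixed term is
  nonnegative on the cone.  This is the convexity of the cone.\<close>

lemma cross_momentum_le:
  fixes r1 r2 E1 E2 m1 m2 :: real
  assumes "r1 \<ge> 0" "E1 \<ge> 0" "m1\<^sup>2 \<le> 2 * r1 * E1" "r2 \<ge> 0" "E2 \<ge> 0" "m2\<^sup>2 \<le> 2 * r2 * E2"
  shows "m1 * m2 \<le> r1 * E2 + r2 * E1"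
proof -
  have "(m1 * m2)\<^sup>2 \<le> (2 * r1 * E1) * (2 * r2 * E2)"
    unfolding power_mult_distrib by (intro mult_mono assms) (use assms in auto)
  also have "\<dots> = (r1 * E2 + r2 * E1)\<^sup>2 - (r1 * E2 - r2 * E1)\<^sup>2"
    by (simp add: power2_eq_square algebra_simps)
  also have "\<dots> \<le> (r1 * E2 + r2 * E1)\<^sup>2" by simp
  finally have "(m1 * m2)\<^sup>2 \<le> (r1 * E2 + r2 * E1)\<^sup>2" .
  moreover have "r1 * E2 + r2 * E1 \<ge> 0" using assms by simp
  ultimately show ?thesis by (rule power2_le_imp_le)
qed

lemma closed_cone_add:
  assumes "U \<in> closed_cone" "V \<in> closed_cone"
  shows "U + V \<in> closed_cone"
proof -
  have "U $ 2 * V $ 2 \<le> U $ 1 * V $ 3 + V $ 1 * U $ 3"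
    using assms by (intro cross_momentum_le) (auto simp: closed_cone_def)
  then show ?thesis
    using assms by (auto simp: closed_cone_def power2_sum algebra_simps)
qed

lemma admissible_add:
  assumes "U \<in> admissible" "V \<in> closed_cone"
  shows "U + V \<in> admissible"
proof -
  have "U $ 2 * V $ 2 \<le> U $ 1 * V $ 3 + V $ 1 * U $ 3"
    using assms admissible_imp_closed_cone[of U]
    by (intro cross_momentum_le) (auto simp: closed_cone_def)
  then show ?thesis
    using assms by (auto simp: closed_cone_def admissible_iff power2_sum algebra_simps)
qed

lemma closed_cone_scaleR:
  assumes "U \<in> closed_cone" "a \<ge> 0"
  shows "a *\<^sub>R U \<in> closed_cone"
proof -
  have "a\<^sup>2 * (U $ 2)\<^sup>2 \<le> a\<^sup>2 * (2 * U $ 1 * U $ 3)"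
    using assms by (intro mult_left_mono) (auto simp: closed_cone_def)
  then show ?thesis using assms
    by (auto simp: closed_cone_def power2_eq_square algebra_simps)
qed

lemma admissible_scaleR:
  assumes "U \<in> admissible" "a > 0"
  shows "a *\<^sub>R U \<in> admissible"
proof -
  have "a\<^sup>2 * (U $ 2)\<^sup>2 < a\<^sup>2 * (2 * U $ 1 * U $ 3)"
    using assms by (intro mult_strict_left_mono) (auto simp: admissible_iff)
  then show ?thesis using assms
    by (auto simp: admissible_iff power2_eq_square algebra_simps)
qed

lemma closed_cone_sum:
  assumes "\<And>i. i \<in> I \<Longrightarrow> f i \<in> closed_cone"
  shows "(\<Sum>i\<in>I. f i) \<in> closed_cone"
  using assms
  by (induction I rule: infinite_finite_induct)
     (auto intro: closed_cone_add, auto simp: closed_cone_def)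

lemma admissible_sum:
  assumes "finite I" "I \<noteq> {}" "\<And>i. i \<in> I \<Longrightarrow> f i \<in> admissible"
  shows "(\<Sum>i\<in>I. f i) \<in> admissible"
proof -
  obtain i where "i \<in> I" using assms by blast
  then have "(\<Sum>i\<in>I. f i) = f i + (\<Sum>i\<in>I - {i}. f i)"
    using assms by (simp add: sum.remove)
  moreover have "f i + (\<Sum>i\<in>I - {i}. f i) \<in> admissible"
    using assms \<open>i \<in> I\<close>
    by (intro admissible_add closed_cone_sum) (auto intro: admissible_imp_closed_cone)
  ultimately show ?thesis by simp
qed


section \<open>Primitive variables\<close>

lemma momentum_eq: "U \<in> admissible \<Longrightarrow> U $ 2 = U $ 1 * velocity U"
  by (auto simp: admissible_iff velocity_def)

lemma energy_eq:
  "U \<in> admissible \<Longrightarrow> U $ 3 = U $ 1 * (internal_energy U + (velocity U)\<^sup>2 / 2)"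
  by (auto simp: admissible_iff velocity_def internal_energy_def field_simps power2_eq_square)

lemma density_pos: "U \<in> admissible \<Longrightarrow> U $ 1 > 0"
  by (simp add: admissible_iff)

lemma internal_energy_pos: "U \<in> admissible \<Longrightarrow> internal_energy U > 0"
  by (auto simp: admissible_def internal_energy_def)

lemma pressure_pos: "\<gamma> > 1 \<Longrightarrow> U \<in> admissible \<Longrightarrow> pressure \<gamma> U > 0"
  by (simp add: pressure_def internal_energy_pos density_pos)

lemma sound_speed_pos: "\<gamma> > 1 \<Longrightarrow> U \<in> admissible \<Longrightarrow> sound_speed \<gamma> U > 0"
  by (simp add: sound_speed_def pressure_pos density_pos)

lemma sound_speed_squared:
  "\<gamma> > 1 \<Longrightarrow> U \<in> admissible \<Longrightarrow> (sound_speed \<gamma> U)\<^sup>2 = \<gamma> * (\<gamma> - 1) * internal_energy U"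
  using density_pos[of U] internal_energy_pos[of U]
  by (simp add: sound_speed_def pressure_def)

lemma velocity_scaleR: "a \<noteq> 0 \<Longrightarrow> velocity (a *\<^sub>R U) = velocity U"
  by (simp add: velocity_def)

lemma internal_energy_scaleR: "a \<noteq> 0 \<Longrightarrow> internal_energy (a *\<^sub>R U) = internal_energy U"
  by (cases "U $ 1 = 0") (simp_all add: internal_energy_def power2_eq_square field_simps)

lemma alpha_max_scaleR: "a \<noteq> 0 \<Longrightarrow> alpha_max \<gamma> (a *\<^sub>R U) = alpha_max \<gamma> U"
  by (cases "U $ 1 = 0")
     (simp_all add: alpha_max_def sound_speed_def pressure_def velocity_scaleR internal_energy_scaleR)

text \<open>The pressure term in the flux shifts the momentum by \<open>p\<close>; this bound says that a wave
  that leaves the fluid at least at the speed of sound carries enough internal energy to afford that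
  shift.  It comes down to \<open>\<gamma> - 1 < 2 \<gamma>\<close>.\<close>

lemma momentum_deficit:
  assumes "U \<in> admissible" "\<gamma> > 1" "w \<ge> sound_speed \<gamma> U"
  shows "(pressure \<gamma> U)\<^sup>2 < 2 * w\<^sup>2 * (U $ 1)\<^sup>2 * internal_energy U"
proof -
  let ?e = "internal_energy U"
  have e: "?e > 0" and r: "U $ 1 > 0" using assms internal_energy_pos density_pos by auto
  have "w\<^sup>2 \<ge> \<gamma> * (\<gamma> - 1) * ?e"
    using assms sound_speed_pos[OF assms(2,1)] sound_speed_squared[OF assms(2,1)]
    by (metis less_eq_real_def power_mono)
  then have "2 * (\<gamma> * (\<gamma> - 1) * ?e) * ((U $ 1)\<^sup>2 * ?e) \<le> 2 * w\<^sup>2 * ((U $ 1)\<^sup>2 * ?e)"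
    using e by (intro mult_right_mono mult_left_mono) auto
  moreover have "(\<gamma> - 1) * ((\<gamma> - 1) * (?e * (U $ 1)\<^sup>2 * ?e)) < 2 * \<gamma> * ((\<gamma> - 1) * (?e * (U $ 1)\<^sup>2 * ?e))"
    using e r assms by (intro mult_strict_right_mono) auto
  ultimately show ?thesis
    by (simp add: pressure_def power2_eq_square algebra_simps)
qed

text \<open>Put \<open>w = \<alpha> + s u\<close>, the speed relative to the fluid.  The discriminant \<open>2 \<rho> E - m\<^sup>2\<close>
  of the combination is \<open>2 w\<^sup>2 \<rho>\<^sup>2 e - p\<^sup>2\<close>, positive by \<open>momentum_deficit\<close>.\<close>

lemma lax_friedrichs_splitting:
  assumes "\<gamma> > 1" "U \<in> admissible" "\<alpha> \<ge> alpha_max \<gamma> U" "\<bar>s\<bar> = 1"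
  shows "\<alpha> *\<^sub>R U + s *\<^sub>R euler_flux \<gamma> U \<in> admissible"
proof -
  define r u e p where "r = U $ 1" "u = velocity U" "e = internal_energy U" "p = pressure \<gamma> U"
  define w where "w = \<alpha> + s * u"
  have comp: "U $ 1 = r" "U $ 2 = r * u" "U $ 3 = r * (e + u\<^sup>2 / 2)"
    using assms(2) momentum_eq energy_eq by (auto simp: r_u_e_p_def)
  have r: "r > 0" using assms(2) density_pos by (simp add: r_u_e_p_def)
  have s: "s * s = 1" using assms(4) by (metis abs_mult_self_eq mult_1)
  have wc: "w \<ge> sound_speed \<gamma> U"
    using assms(3,4) by (auto simp: alpha_max_def w_def r_u_e_p_def abs_if split: if_splits)
  then have w: "w > 0" using sound_speed_pos assms by force
  have "p\<^sup>2 < 2 * w\<^sup>2 * r\<^sup>2 * e"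
    using momentum_deficit[OF assms(2,1) wc] by (simp add: r_u_e_p_def)
  moreover have "(\<alpha> *\<^sub>R U + s *\<^sub>R euler_flux \<gamma> U) $ 1 = r * w"
    and "(\<alpha> *\<^sub>R U + s *\<^sub>R euler_flux \<gamma> U) $ 2 = r * u * w + s * p"
    and "(\<alpha> *\<^sub>R U + s *\<^sub>R euler_flux \<gamma> U) $ 3 = r * (e + u\<^sup>2 / 2) * w + s * p * u"
    using comp by (simp_all add: euler_flux_def vector_3 w_def flip: r_u_e_p_def)
      (simp_all add: algebra_simps power2_eq_square)
  moreover have "2 * (r * w) * (r * (e + u\<^sup>2 / 2) * w + s * p * u) - (r * u * w + s * p)\<^sup>2
      = 2 * w\<^sup>2 * r\<^sup>2 * e - (s * s) * p\<^sup>2"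
    by (simp add: power2_eq_square algebra_simps)
  ultimately show ?thesis
    unfolding admissible_iff using r w s by simp
qed


section \<open>The HLLC fan\<close>

text \<open>With \<open>q = p / (\<rho> (S - u))\<close>, twice the specific internal energy of the star state is
  \<open>(S\<^sub>* - u + q)\<^sup>2 + 2 e - q\<^sup>2\<close>, and \<open>q\<^sup>2 < 2 e\<close> because the outer wave is at least as
  fast as sound relative to the fluid.\<close>

lemma star_state_admissible:
  assumes "\<gamma> > 1" "U \<in> admissible" "\<bar>S - velocity U\<bar> \<ge> sound_speed \<gamma> U"
    and "(S - velocity U) / (S - Ss) > 0"
  shows "star_state \<gamma> S Ss U \<in> admissible"
proof -
  define r u e p where "r = U $ 1" "u = velocity U" "e = internal_energy U" "p = pressure \<gamma> U"
  have r: "r > 0" using assms(2) density_pos by (simp add: r_u_e_p_def)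
  have k: "(S - u) / (S - Ss) > 0" using assms(4) by (simp add: r_u_e_p_def)
  then have Su: "S - u \<noteq> 0" by auto
  define q where "q = p / (r * (S - u))"
  have "p\<^sup>2 < 2 * (S - u)\<^sup>2 * r\<^sup>2 * e"
    using momentum_deficit[OF assms(2,1,3)] by (simp add: r_u_e_p_def)
  then have q: "q\<^sup>2 < 2 * e"
    using r Su by (simp add: q_def power_divide power_mult_distrib pos_divide_less_eq mult_ac)
  define \<epsilon> where "\<epsilon> = U $ 3 / r + (Ss - u) * (Ss + q)"
  have "U $ 3 / r = e + u\<^sup>2 / 2"
    using assms(2) energy_eq[of U] r by (simp add: r_u_e_p_def)
  then have "2 * \<epsilon> - Ss\<^sup>2 = (Ss - u + q)\<^sup>2 + (2 * e - q\<^sup>2)"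
    by (simp add: \<epsilon>_def power2_eq_square algebra_simps)
  then have "Ss\<^sup>2 < 2 * \<epsilon>" using q by (smt (verit) zero_le_power2)
  then have "vector [1, Ss, \<epsilon>] \<in> admissible"
    by (simp add: admissible_iff vector_3)
  moreover have "star_state \<gamma> S Ss U = (r * ((S - u) / (S - Ss))) *\<^sub>R vector [1, Ss, \<epsilon>]"
    by (simp add: star_state_def Let_def \<epsilon>_def q_def r_u_e_p_def)
  ultimately show ?thesis
    using admissible_scaleR[OF _ mult_pos_pos[OF r k]] by simp
qed

text \<open>Seen from a frame that moves with the contact, the star state is at rest and its flux is only
  that of a pressure \<open>p\<^sub>*\<close>.  If both sides have the same \<open>p\<^sub>*\<close>, this is the
  Rankine--Hugoniot condition across the contact.\<close>

lemma star_flux_comoving: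
  fixes \<gamma> S Ss :: real
  assumes "U \<in> admissible" "S \<noteq> velocity U" "S \<noteq> Ss"
  defines "ps \<equiv> pressure \<gamma> U + U $ 1 * (S - velocity U) * (Ss - velocity U)"
  shows "star_flux \<gamma> S Ss U - Ss *\<^sub>R star_state \<gamma> S Ss U = vector [0, ps, Ss * ps]"
proof -
  define r u p E where "r = U $ 1" "u = velocity U" "p = pressure \<gamma> U" "E = U $ 3"
  have r: "r \<noteq> 0" using assms(1) density_pos by (force simp: r_u_p_E_def)
  have m: "U $ 2 = r * u" using assms(1) momentum_eq by (simp add: r_u_p_E_def)
  define k where "k = r * ((S - u) / (S - Ss))"
  have k: "(S - Ss) * k = r * (S - u)" using assms(3) by (simp add: k_def)
  have Su: "S - u \<noteq> 0" using assms(2) by (simp add: r_u_p_E_def)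
  define \<epsilon> where "\<epsilon> = E / r + (Ss - u) * (Ss + p / (r * (S - u)))"
  have "r * (S - u) * \<epsilon> = E * (S - u) + (Ss - u) * (r * (S - u) * Ss + p)"
    using r Su by (simp add: \<epsilon>_def field_simps)
  then have k3: "(S - Ss) * (k * \<epsilon>) = E * (S - u) + (Ss - u) * (r * (S - u) * Ss + p)"
    using k by (metis mult.assoc)
  have k2: "(S - Ss) * (k * Ss) = r * (S - u) * Ss" using k by (metis mult.assoc)
  have st: "star_state \<gamma> S Ss U = k *\<^sub>R vector [1, Ss, \<epsilon>]"
    by (simp add: star_state_def Let_def k_def \<epsilon>_def r_u_p_E_def)
  have ps: "ps = p + r * (S - u) * (Ss - u)" by (simp add: ps_def r_u_p_E_def)
  have "r * u + S * (k - r) - Ss * k = 0" using k by (simp add: algebra_simps)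
  moreover have "r * u\<^sup>2 + p + S * (k * Ss - r * u) - Ss * (k * Ss) = ps"
    using k2 unfolding ps by (simp add: algebra_simps power2_eq_square)
  moreover have "(E + p) * u + S * (k * \<epsilon> - E) - Ss * (k * \<epsilon>) = Ss * ps"
    using k3 unfolding ps by (simp add: algebra_simps power2_eq_square)
  ultimately show ?thesis
    unfolding vec_eq_iff forall_3 star_flux_def st euler_flux_def
    by (simp add: vector_3 m flip: r_u_p_E_def)
qed

text \<open>The contact speed is the one for which the star pressures of the two sides agree (last claim).
  With the mass fluxes \<open>a\<^sub>L\<close>, \<open>a\<^sub>R\<close> into the two outer waves it is the weighted mean
  of the velocities, corrected by \<open>(p\<^sub>L - p\<^sub>R) / (a\<^sub>L + a\<^sub>R)\<close>.  The correction does not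
  push it past an outer wave since \<open>a\<^sub>L\<close> times a relative speed is at least
  \<open>\<rho>\<^sub>L c\<^sub>L\<^sup>2 = \<gamma> p\<^sub>L > p\<^sub>L\<close>, and likewise on the right.\<close>

lemma wave_speed_order:
  fixes \<gamma> :: real
  assumes "\<gamma> > 1" "UL \<in> admissible" "UR \<in> admissible"
  defines "SL \<equiv> speed_L \<gamma> UL UR" and "SR \<equiv> speed_R \<gamma> UL UR" and "Ss \<equiv> speed_star \<gamma> UL UR"
  shows "SL < Ss" "Ss < SR"
    and "pressure \<gamma> UL + UL $ 1 * (SL - velocity UL) * (Ss - velocity UL)
       = pressure \<gamma> UR + UR $ 1 * (SR - velocity UR) * (Ss - velocity UR)"
proof -
  define rL uL pL cL where "rL = UL $ 1" "uL = velocity UL" "pL = pressure \<gamma> UL" "cL = sound_speed \<gamma> UL"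
  define rR uR pR cR where "rR = UR $ 1" "uR = velocity UR" "pR = pressure \<gamma> UR" "cR = sound_speed \<gamma> UR"
  note d = rL_uL_pL_cL_def rR_uR_pR_cR_def
  have pos: "rL > 0" "rR > 0" "pL > 0" "pR > 0" "cL > 0" "cR > 0"
    using assms(1-3) density_pos pressure_pos sound_speed_pos by (auto simp: d)
  have rc: "rL * cL\<^sup>2 = \<gamma> * pL" "rR * cR\<^sup>2 = \<gamma> * pR"
    unfolding d using sound_speed_squared assms(1-3) by (auto simp: pressure_def)
  have S: "SL \<le> uL - cL" "SL \<le> uR - cR" "SR \<ge> uL + cL" "SR \<ge> uR + cR"
    by (auto simp: SL_def SR_def speed_L_def speed_R_def alpha_minus_def alpha_plus_def d)
  define aL aR where "aL = rL * (uL - SL)" "aR = rR * (SR - uR)"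
  have a: "aL > 0" "aR > 0" using pos S by (auto simp: aL_aR_def)
  have "Ss = (pR - pL - aL * uL - aR * uR) / - (aL + aR)"
    by (simp add: Ss_def speed_star_def Let_def d aL_aR_def SL_def SR_def algebra_simps)
  then have Ss: "Ss * (aL + aR) = pL - pR + aL * uL + aR * uR"
    using a by (simp add: field_simps)
  have "rR * (cR * cR) \<le> aR * (uR - SL)" 
    unfolding aL_aR_def mult.assoc using S pos by (intro mult_left_mono mult_mono) auto
  moreover have "pR < \<gamma> * pR" "pL < \<gamma> * pL" using pos assms(1) by auto
  moreover have "aL * (uL - SL) > 0" using a S pos by simp
  moreover have "Ss * (aL + aR) - SL * (aL + aR) = pL - pR + aL * (uL - SL) + aR * (uR - SL)"
    unfolding Ss by (simp add: algebra_simps)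
  ultimately have "SL * (aL + aR) < Ss * (aL + aR)"
    using rc(2)[unfolded power2_eq_square] pos by linarith
  then show "SL < Ss" using a by simp
  have "rL * (cL * cL) \<le> aL * (SR - uL)" 
    unfolding aL_aR_def mult.assoc using S pos by (intro mult_left_mono mult_mono) auto
  moreover have "pL < \<gamma> * pL" using pos assms(1) by auto
  moreover have "aR * (SR - uR) > 0" using a S pos by simp
  moreover have "SR * (aL + aR) - Ss * (aL + aR) = pR - pL + aR * (SR - uR) + aL * (SR - uL)"
    unfolding Ss by (simp add: algebra_simps)
  ultimately have "Ss * (aL + aR) < SR * (aL + aR)"
    using rc(1)[unfolded power2_eq_square] pos by linarith
  then show "Ss < SR" using a by simp
  show "pressure \<gamma> UL + UL $ 1 * (SL - velocity UL) * (Ss - velocity UL)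
       = pressure \<gamma> UR + UR $ 1 * (SR - velocity UR) * (Ss - velocity UR)"
    using Ss unfolding aL_aR_def by (simp add: algebra_simps flip: d)
qed

text \<open>Both claims are integrals of the piecewise constant fan \<open>UL, VL, VR, UR\<close> with jumps at
  \<open>SL < Ss < SR\<close>: over \<open>[-\<alpha>, 0]\<close> for the first and over \<open>[0, \<alpha>]\<close> for the
  second.\<close>

lemma hllc_flux_fan:
  assumes "\<gamma> > 1" "UL \<in> admissible" "UR \<in> admissible"
    and "\<alpha> \<ge> alpha_max \<gamma> UL" "\<alpha> \<ge> alpha_max \<gamma> UR"
  shows "\<alpha> *\<^sub>R UL + euler_flux \<gamma> UL - hllc_flux \<gamma> UL UR \<in> closed_cone" (is ?left)
    and "\<alpha> *\<^sub>R UR - euler_flux \<gamma> UR + hllc_flux \<gamma> UL UR \<in> closed_cone" (is ?right)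
proof -
  define SL SR Ss where "SL = speed_L \<gamma> UL UR" "SR = speed_R \<gamma> UL UR" "Ss = speed_star \<gamma> UL UR"
  note d = SL_SR_Ss_def
  note order = wave_speed_order[OF assms(1-3), folded d]
  define VL VR where "VL = star_state \<gamma> SL Ss UL" "VR = star_state \<gamma> SR Ss UR"
  have c: "sound_speed \<gamma> UL > 0" "sound_speed \<gamma> UR > 0"
    using assms sound_speed_pos by auto
  have bnd: "\<bar>SL\<bar> \<le> \<alpha>" "\<bar>SR\<bar> \<le> \<alpha>"
    using assms(4,5) c
    by (auto simp: d speed_L_def speed_R_def alpha_minus_def alpha_plus_def alpha_max_def min_def max_def)
  have gap: "sound_speed \<gamma> UL \<le> velocity UL - SL" "sound_speed \<gamma> UR \<le> SR - velocity UR"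
    by (auto simp: d speed_L_def speed_R_def alpha_minus_def alpha_plus_def)
  have "VL \<in> admissible" unfolding VL_VR_def
    using gap c order by (intro star_state_admissible assms) (auto intro: divide_neg_neg)
  moreover have "VR \<in> admissible" unfolding VL_VR_def
    using gap c order by (intro star_state_admissible assms) auto
  ultimately have cone: "UL \<in> closed_cone" "VL \<in> closed_cone" "VR \<in> closed_cone" "UR \<in> closed_cone"
    using assms admissible_imp_closed_cone by auto
  have "star_flux \<gamma> SL Ss UL - Ss *\<^sub>R VL = star_flux \<gamma> SR Ss UR - Ss *\<^sub>R VR"
    unfolding VL_VR_def using gap c order
    by (subst (1 2) star_flux_comoving) (auto simp: assms)
  then have contact: "euler_flux \<gamma> UL + SL *\<^sub>R (VL - UL) - Ss *\<^sub>R VL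
      = euler_flux \<gamma> UR + SR *\<^sub>R (VR - UR) - Ss *\<^sub>R VR"
    unfolding star_flux_def VL_VR_def .
  have comb: "a *\<^sub>R UL + b *\<^sub>R VL + c *\<^sub>R VR + d *\<^sub>R UR \<in> closed_cone"
    if "a \<ge> 0" "b \<ge> 0" "c \<ge> 0" "d \<ge> 0" for a b c d
    by (intro closed_cone_add closed_cone_scaleR cone that)
  \<comment> \<open>Rankine--Hugoniot conditions over the whole fan.\<close>
  have jump: "euler_flux \<gamma> UR = euler_flux \<gamma> UL + SL *\<^sub>R (VL - UL) + Ss *\<^sub>R (VR - VL) + SR *\<^sub>R (UR - VR)"
    using contact by (simp add: algebra_simps)
  \<comment> \<open>Cutting the wave speeds off at zero puts the four branches of the flux into one formula;
    \<open>S - t S\<close> is then the part of the wave that runs to the right.\<close>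
  define t where "t S = min S 0" for S :: real
  have fan: "hllc_flux \<gamma> UL UR
      = euler_flux \<gamma> UL + t SL *\<^sub>R (VL - UL) + t Ss *\<^sub>R (VR - VL) + t SR *\<^sub>R (UR - VR)"
    using order(1,2) unfolding hllc_flux_def Let_def d[symmetric] star_flux_def VL_VR_def[symmetric] t_def
    by (auto simp: jump min_def algebra_simps)
  have mono: "- \<alpha> \<le> t SL" "t SL \<le> t Ss" "t Ss \<le> t SR" "t SR \<le> 0"
    "SL - t SL \<le> Ss - t Ss" "Ss - t Ss \<le> SR - t SR" "0 \<le> SL - t SL" "SR - t SR \<le> \<alpha>"
    using bnd order(1,2) by (auto simp: t_def min_def)
  have "\<alpha> *\<^sub>R UL + euler_flux \<gamma> UL - hllc_flux \<gamma> UL UR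
      = (\<alpha> + t SL) *\<^sub>R UL + (t Ss - t SL) *\<^sub>R VL + (t SR - t Ss) *\<^sub>R VR + (- t SR) *\<^sub>R UR"
    unfolding fan by (simp add: algebra_simps)
  also have "\<dots> \<in> closed_cone" by (rule comb) (use mono in auto)
  finally show ?left .
  have "\<alpha> *\<^sub>R UR - euler_flux \<gamma> UR + hllc_flux \<gamma> UL UR
      = (SL - t SL) *\<^sub>R UL + ((Ss - t Ss) - (SL - t SL)) *\<^sub>R VL
        + ((SR - t SR) - (Ss - t Ss)) *\<^sub>R VR + (\<alpha> - (SR - t SR)) *\<^sub>R UR"
    unfolding fan jump by (simp add: algebra_simps)
  also have "\<dots> \<in> closed_cone" by (rule comb) (use mono in auto)
  finally show ?right .
qed

text \<open>Half of the multiple \<open>2 \<alpha>\<close> serves the exact flux of the state, the other half the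
  deviation of the numerical flux from it.  This is the factor 2 in the CFL quantity.\<close>

lemma hllc_flux_one_sided:
  assumes "\<gamma> > 1" "UL \<in> admissible" "UR \<in> admissible"
    and "\<alpha> \<ge> alpha_max \<gamma> UL" "\<alpha> \<ge> alpha_max \<gamma> UR"
  shows "(2 * \<alpha>) *\<^sub>R UL - hllc_flux \<gamma> UL UR \<in> admissible"
    and "(2 * \<alpha>) *\<^sub>R UR + hllc_flux \<gamma> UL UR \<in> admissible"
proof -
  have "(\<alpha> *\<^sub>R UL + (-1) *\<^sub>R euler_flux \<gamma> UL) + (\<alpha> *\<^sub>R UL + euler_flux \<gamma> UL - hllc_flux \<gamma> UL UR) \<in> admissible"
    using assms by (intro admissible_add lax_friedrichs_splitting hllc_flux_fan) auto
  then show "(2 * \<alpha>) *\<^sub>R UL - hllc_flux \<gamma> UL UR \<in> admissible"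
    by (simp add: scaleR_2 flip: scaleR_scaleR)
  have "(\<alpha> *\<^sub>R UR + 1 *\<^sub>R euler_flux \<gamma> UR) + (\<alpha> *\<^sub>R UR - euler_flux \<gamma> UR + hllc_flux \<gamma> UL UR) \<in> admissible"
    using assms by (intro admissible_add lax_friedrichs_splitting hllc_flux_fan) auto
  then show "(2 * \<alpha>) *\<^sub>R UR + hllc_flux \<gamma> UL UR \<in> admissible"
    by (simp add: scaleR_2 flip: scaleR_scaleR)
qed


section \<open>The source term\<close>

text \<open>The source of a gravitational force: it feeds density into momentum and momentum into energy.\<close>

definition forcing :: "real \<Rightarrow> real ^ 3 \<Rightarrow> real ^ 3" where
  "forcing \<beta> U = vector [0, \<beta> * U $ 1, \<beta> * U $ 2]"

text \<open>The discriminant of the sum is \<open>\<rho>\<^sup>2 (2 \<kappa>\<^sup>2 e - \<beta>\<^sup>2)\<close>: to first order a force changes the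
  velocity and leaves the internal energy alone, and only its square is an expense.\<close>

lemma forcing_closed_cone:
  assumes "U \<in> admissible" "\<bar>\<beta>\<bar> \<le> \<kappa> * sqrt (2 * internal_energy U)"
  shows "\<kappa> *\<^sub>R U + forcing \<beta> U \<in> closed_cone"
proof -
  define r u e where "r = U $ 1" "u = velocity U" "e = internal_energy U"
  have pos: "r > 0" "e > 0" using assms(1) density_pos internal_energy_pos by (auto simp: r_u_e_def)
  have comp: "U $ 1 = r" "U $ 2 = r * u" "U $ 3 = r * (e + u\<^sup>2 / 2)"
    using assms(1) momentum_eq energy_eq by (auto simp: r_u_e_def)
  have b: "\<bar>\<beta>\<bar> \<le> \<kappa> * sqrt (2 * e)" using assms(2) by (simp add: r_u_e_def)
  then have \<kappa>: "\<kappa> \<ge> 0" using pos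
    by (metis abs_ge_zero order_trans zero_le_mult_iff mult_pos_pos not_less real_sqrt_gt_0_iff zero_less_numeral)
  have "\<bar>\<beta>\<bar>\<^sup>2 \<le> (\<kappa> * sqrt (2 * e))\<^sup>2" by (rule power_mono[OF b]) simp
  then have b2: "\<beta>\<^sup>2 \<le> 2 * \<kappa>\<^sup>2 * e" using pos by (simp add: power_mult_distrib)
  let ?E = "\<kappa> * (e + u\<^sup>2 / 2) + \<beta> * u"
  have E: "0 \<le> ?E"
  proof (cases "\<kappa> = 0")
    case True
    then show ?thesis using b by simp
  next
    case False
    have "2 * \<kappa> * ?E = (\<kappa> * u + \<beta>)\<^sup>2 + (2 * \<kappa>\<^sup>2 * e - \<beta>\<^sup>2)"
      by (simp add: power2_eq_square algebra_simps)
    also have "\<dots> \<ge> 0" using b2 by simp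
    finally show ?thesis using False \<kappa> by (simp add: zero_le_mult_iff)
  qed
  have "2 * (\<kappa> * r) * (r * ?E) - (\<kappa> * (r * u) + \<beta> * r)\<^sup>2 = r\<^sup>2 * (2 * \<kappa>\<^sup>2 * e - \<beta>\<^sup>2)"
    by (simp add: power2_eq_square algebra_simps)
  also have "\<dots> \<ge> 0" using b2 by simp
  finally have m: "(\<kappa> * (r * u) + \<beta> * r)\<^sup>2 \<le> 2 * (\<kappa> * r) * (r * ?E)" by simp
  have "(\<kappa> *\<^sub>R U + forcing \<beta> U) $ 1 = \<kappa> * r"
    and "(\<kappa> *\<^sub>R U + forcing \<beta> U) $ 2 = \<kappa> * (r * u) + \<beta> * r"
    and "(\<kappa> *\<^sub>R U + forcing \<beta> U) $ 3 = r * ?E"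
    by (simp_all add: forcing_def vector_3 comp) (simp add: algebra_simps)
  then show ?thesis
    unfolding closed_cone_def mem_Collect_eq using pos \<kappa> E m by (metis less_eq_real_def mult_nonneg_nonneg)
qed


section \<open>Quadrature rules\<close>

text \<open>Testing the rule with a nonnegative polynomial that vanishes at all nodes but one leaves only
  that weight, times a positive value, against a positive integral.\<close>

lemma quad_weight_pos:
  assumes "quad_exact n \<xi> w d" "degree p \<le> d" "i \<in> {1..n}"
    and "\<And>y. -1 \<le> y \<Longrightarrow> y \<le> 1 \<Longrightarrow> poly p y \<ge> 0"
    and "\<And>j. j \<in> {1..n} \<Longrightarrow> j \<noteq> i \<Longrightarrow> poly p (\<xi> j) = 0"
    and "-1 \<le> \<xi> i" "\<xi> i \<le> 1" "poly p (\<xi> i) \<noteq> 0"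
  shows "w i > 0"
proof -
  have "(\<Sum>j = 1..n. w j * poly p (\<xi> j)) = w i * poly p (\<xi> i) + (\<Sum>j\<in>{1..n} - {i}. w j * poly p (\<xi> j))"
    using assms(3) by (simp add: sum.remove)
  also have "(\<Sum>j\<in>{1..n} - {i}. w j * poly p (\<xi> j)) = 0"
    using assms(5) by (intro sum.neutral) auto
  finally have eq: "w i * poly p (\<xi> i) = integral {-1..1} (poly p) / 2"
    using assms(1,2) by (auto simp: quad_exact_def)
  have cont: "continuous_on {-1..1} (poly p)" by (intro continuous_intros)
  have "integral {-1..1} (poly p) \<noteq> 0"
    using integral_eq_0_iff[OF cont] assms(4,6-8) by auto
  moreover have "integral {-1..1} (poly p) \<ge> 0"
    using assms(4) by (intro integral_nonneg integrable_continuous_real cont) auto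
  ultimately have "w i * poly p (\<xi> i) > 0" using eq by simp
  then show ?thesis using assms(4,6,7) by (smt (verit) mult_nonpos_nonneg)
qed

definition node_poly :: "(nat \<Rightarrow> real) \<Rightarrow> nat set \<Rightarrow> real poly" where
  "node_poly \<xi> I = (\<Prod>j\<in>I. [:- \<xi> j, 1:])"

lemma poly_node_poly: "poly (node_poly \<xi> I) y = (\<Prod>j\<in>I. y - \<xi> j)"
  by (simp add: node_poly_def poly_prod)

lemma degree_node_poly: "degree (node_poly \<xi> I) = card I"
  by (cases "finite I") (simp_all add: node_poly_def degree_prod_eq_sum_degree)

lemma poly_node_poly_eq_0_iff: "finite I \<Longrightarrow> poly (node_poly \<xi> I) y = 0 \<longleftrightarrow> (\<exists>j\<in>I. y = \<xi> j)"
  by (auto simp: poly_node_poly)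

lemma gauss_weight_pos:
  assumes "gauss_rule n \<xi> w" "i \<in> {1..n}"
  shows "w i > 0"
proof -
  have inj: "inj_on \<xi> {1..n}" and q: "quad_exact n \<xi> w (2 * n - 1)"
    using assms(1) by (auto simp: gauss_rule_def strict_mono_on_imp_inj_on)
  let ?p = "(node_poly \<xi> ({1..n} - {i}))\<^sup>2"
  have "degree ?p \<le> 2 * (n - 1)"
    using assms(2) degree_power_le[of "node_poly \<xi> ({1..n} - {i})" 2] by (simp add: degree_node_poly)
  then have "degree ?p \<le> 2 * n - 1" by simp
  moreover have "-1 \<le> \<xi> i" "\<xi> i \<le> 1" using assms by (auto simp: gauss_rule_def less_eq_real_def)
  ultimately show ?thesis
    using assms(2) by (intro quad_weight_pos[OF q]) (auto simp: poly_node_poly_eq_0_iff inj_on_eq_iff[OF inj])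
qed

lemma gauss_lobatto_weight_pos:
  assumes "gauss_lobatto_rule n \<xi> w" "i \<in> {1..n}"
  shows "w i > 0"
proof -
  have n: "n \<ge> 2" and ends: "\<xi> 1 = -1" "\<xi> n = 1" and inj: "inj_on \<xi> {1..n}"
    and mono: "strict_mono_on {1..n} \<xi>" and q: "quad_exact n \<xi> w (2 * n - 3)"
    using assms(1) by (auto simp: gauss_lobatto_rule_def strict_mono_on_imp_inj_on)
  have le: "\<xi> j \<le> \<xi> l" if "j \<in> {1..n}" "l \<in> {1..n}" "j \<le> l" for j l
    using strict_mono_on_leD[OF mono] that by auto
  have bnd: "-1 \<le> \<xi> i" "\<xi> i \<le> 1"
    using le[of 1 i] le[of i n] ends assms(2) n by auto
  define I where "I = {1..n} - {1, n, i}"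
  \<comment> \<open>An end node other than \<open>\<xi> i\<close> can only afford a simple zero: a square there would exceed
    the degree of exactness, and a simple zero at an end of the interval does not change sign.\<close>
  define r :: "real poly" where "r = (if i = 1 then [:1, -1:] else if i = n then [:1, 1:] else [:1, 0, -1:])"
  let ?p = "r * (node_poly \<xi> I)\<^sup>2"
  have card: "card I = n - card {1, n, i}"
    unfolding I_def using n assms(2) by (subst card_Diff_subset) auto
  have "degree ?p \<le> degree r + 2 * card I"
    using degree_mult_le[of r "(node_poly \<xi> I)\<^sup>2"] degree_power_le[of "node_poly \<xi> I" 2]
    by (simp add: degree_node_poly mult.commute)
  also have "\<dots> \<le> 2 * n - 3"
    using n assms(2) unfolding card r_def by (auto simp: card_insert_if)
  finally have deg: "degree ?p \<le> 2 * n - 3" .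
  have inj': "\<xi> j = \<xi> l \<longleftrightarrow> j = l" if "j \<in> {1..n}" "l \<in> {1..n}" for j l
    using inj_on_eq_iff[OF inj] that by blast
  have ri: "poly r (\<xi> i) \<noteq> 0"
  proof -
    have "(1 - \<xi> i) * (1 + \<xi> i) \<noteq> 0" if "i \<noteq> 1" "i \<noteq> n"
      using inj'[of i 1] inj'[of i n] that assms(2) n ends by (auto simp: add_eq_0_iff)
    then show ?thesis using ends n by (auto simp: r_def algebra_simps)
  qed
  show ?thesis
  proof (rule quad_weight_pos[OF q deg assms(2) _ _ bnd])
    show "poly ?p y \<ge> 0" if "-1 \<le> y" "y \<le> 1" for y
    proof -
      have "y * y \<le> 1" using that by (metis abs_le_iff abs_mult_self_eq abs_square_le_1 minus_le_iff power2_eq_square)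
      then have "poly r y \<ge> 0" using that by (auto simp: r_def)
      then show ?thesis by simp
    qed
    show "poly ?p (\<xi> j) = 0" if "j \<in> {1..n}" "j \<noteq> i" for j
    proof (cases "j \<in> I")
      case True
      then show ?thesis by (auto simp: poly_node_poly_eq_0_iff I_def)
    next
      case False
      then have "j = 1 \<or> j = n" using that by (auto simp: I_def)
      then show ?thesis using ends that by (auto simp: r_def)
    qed
    show "poly ?p (\<xi> i) \<noteq> 0"
      using ri inj' assms(2) by (auto simp: poly_node_poly_eq_0_iff I_def)
  qed
qed

text \<open>Only the first weight enters the CFL condition, but both end states have to be paid for.  Let
  \<open>f\<close> vanish at the interior nodes; then \<open>g(y) = f(y) f(-y)\<close> is even and vanishes there
  too.  Testing with \<open>(1 + y) g\<close> isolates the last weight and with \<open>(1 - y) g\<close> the first,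
  and by reflection the integrals agree.\<close>

lemma gauss_lobatto_end_weights_eq:
  assumes "gauss_lobatto_rule n \<xi> w"
  shows "w n = w 1"
proof -
  have n: "n \<ge> 2" and ends: "\<xi> 1 = -1" "\<xi> n = 1" and inj: "inj_on \<xi> {1..n}"
    and q: "quad_exact n \<xi> w (2 * n - 3)"
    using assms(1) by (auto simp: gauss_lobatto_rule_def strict_mono_on_imp_inj_on)
  define I where "I = {1..n} - {1, n}"
  define f where "f = node_poly \<xi> I"
  define g where "g = f * pcompose f [:0, -1:]"
  have card: "card I = n - 2" unfolding I_def using n by (subst card_Diff_subset) auto
  have f0: "poly f (\<xi> j) = 0" if "j \<in> I" for j
    using that by (auto simp: f_def poly_node_poly_eq_0_iff I_def)
  have "poly f 1 \<noteq> 0 \<and> poly f (-1) \<noteq> 0"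
  proof -
    have "1 \<noteq> \<xi> j" "-1 \<noteq> \<xi> j" if "j \<in> I" for j
      using inj that n ends unfolding I_def inj_on_def by (metis DiffE atLeastAtMost_iff insertCI le_trans one_le_numeral order_refl)+
    then show ?thesis by (auto simp: f_def poly_node_poly_eq_0_iff I_def)
  qed
  then have g1: "poly g 1 \<noteq> 0" "poly g (-1) = poly g 1"
    by (auto simp: g_def poly_pcompose)
  have "degree g \<le> card I + card I"
    using degree_mult_le[of f "pcompose f [:0, -1:]"]
    by (simp add: g_def f_def degree_node_poly degree_pcompose)
  then have degg: "degree g + 1 \<le> 2 * n - 3" using card n by auto
  have rule: "2 * (\<Sum>i\<in>{1, n}. w i * ((1 + s * \<xi> i) * poly g (\<xi> i)))
       = integral {-1..1} (\<lambda>y. (1 + s * y) * poly g y)" for s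
  proof -
    have "degree ([:1, s:] * g) \<le> 2 * n - 3"
      using degree_mult_le[of "[:1, s:]" g] degg by (auto split: if_splits)
    moreover have factor: "poly ([:1, s:] * g) = (\<lambda>y. (1 + s * y) * poly g y)"
      by (simp add: fun_eq_iff algebra_simps)
    ultimately have "(\<Sum>i = 1..n. w i * ((1 + s * \<xi> i) * poly g (\<xi> i)))
        = integral {-1..1} (\<lambda>y. (1 + s * y) * poly g y) / 2"
      using q unfolding quad_exact_def by (metis (no_types, lifting) sum.cong)
    moreover have "(\<Sum>i = 1..n. w i * ((1 + s * \<xi> i) * poly g (\<xi> i)))
        = (\<Sum>i\<in>{1, n}. w i * ((1 + s * \<xi> i) * poly g (\<xi> i)))"
      using n f0 by (intro sum.mono_neutral_right) (auto simp: I_def g_def)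
    ultimately show ?thesis by simp
  qed
  have refl: "integral {-1..1} (\<lambda>y. (1 + s * y) * poly g y) = integral {-1..1} (\<lambda>y. (1 - s * y) * poly g y)" for s
  proof -
    have "poly g (- y) = poly g y" for y by (simp add: g_def poly_pcompose mult.commute)
    then show ?thesis
      using Henstock_Kurzweil_Integration.integral_reflect_real[of 1 "-1" "\<lambda>y. (1 - s * y) * poly g y"] by simp
  qed
  have "n \<noteq> 1" using n by simp
  then have "4 * (w n * poly g 1) = integral {-1..1} (\<lambda>y. (1 + y) * poly g y)"
    and "4 * (w 1 * poly g 1) = integral {-1..1} (\<lambda>y. (1 - y) * poly g y)"
    using rule[of 1] rule[of "-1"] ends g1(2) by simp_all
  then have "w n * poly g 1 = w 1 * poly g 1" using refl[of 1, unfolded mult_1] by linarith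
  then show ?thesis using g1(1) by simp
qed


section \<open>Cell averages\<close>

lemma cell_average_quad:
  assumes "quad_exact n \<xi> w d" "degree (f j) \<le> d" "x (j - 1) < x j"
  shows "cell_average x f j = (\<Sum>i = 1..n. w i * poly (f j) (cell_node x \<xi> j i))"
proof -
  define h c where "h = cell_size x j / 2" "c = (x (j - 1) + x j) / 2"
  have h: "h > 0" using assms(3) by (simp add: h_c_def cell_size_def)
  have ends: "c - h = x (j - 1)" "c + h = x j" by (simp_all add: h_c_def cell_size_def field_simps)
  define p where "p = pcompose (f j) [:c, h:]"
  have py: "poly p y = poly (f j) (h * y + c)" for y
    by (simp add: p_def poly_pcompose algebra_simps)
  have img: "(\<lambda>t. (1 / h) *\<^sub>R t + - ((1 / h) *\<^sub>R c)) ` {x (j - 1)..x j} = {-1..1}"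
  proof -
    have "(1 / h) *\<^sub>R (x (j - 1)) + - ((1 / h) *\<^sub>R c) = -1" "(1 / h) *\<^sub>R (x j) + - ((1 / h) *\<^sub>R c) = 1"
      unfolding ends[symmetric] using h by (simp_all add: field_simps)
    moreover have "1 / h \<ge> 0" using h by simp
    ultimately show ?thesis
      using image_affinity_atLeastAtMost[of "1/h" "- ((1 / h) *\<^sub>R c)" "x (j - 1)" "x j"] assms(3)
      by auto
  qed
  have "(poly (f j) has_integral integral {x (j - 1)..x j} (poly (f j))) (cbox (x (j - 1)) (x j))"
    by (simp add: integrable_integral integrable_continuous_real continuous_intros)
  from has_integral_affinity[OF this, of h c]
  have "(poly p has_integral (1 / h) * integral {x (j - 1)..x j} (poly (f j))) {-1..1}"
    using h img by (simp add: py[abs_def])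
  then have "integral {-1..1} (poly p) / 2 = cell_average x f j"
    by (simp add: integral_unique cell_average_def h_c_def)
  moreover have "degree p \<le> d"
    using assms(2) degree_pcompose_le[of "f j" "[:c, h:]"] h by (simp add: p_def)
  ultimately have "cell_average x f j = (\<Sum>i = 1..n. w i * poly p (\<xi> i))"
    using assms(1) unfolding quad_exact_def by metis
  then show ?thesis
    by (simp add: py cell_node_def h_c_def algebra_simps)
qed

lemma state_average_quad:
  assumes "quad_exact n \<xi> w d" "\<And>i. degree (U j $ i) \<le> d" "x (j - 1) < x j"
  shows "state_average x U j = (\<Sum>i = 1..n. w i *\<^sub>R state_at U j (cell_node x \<xi> j i))"
  unfolding vec_eq_iff
  using cell_average_quad[OF assms(1) _ assms(3), of "\<lambda>j. U j $ _"] assms(2)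
  by (simp add: state_average_def state_at_def)

lemma quad_pderiv:
  assumes "quad_exact n \<xi> w d" "degree (f j) \<le> d" "x (j - 1) < x j"
  shows "cell_size x j * (\<Sum>i = 1..n. w i * poly (pderiv (f j)) (cell_node x \<xi> j i))
    = poly (f j) (x j) - poly (f j) (x (j - 1))"
proof -
  have "(poly (pderiv (f j)) has_integral poly (f j) (x j) - poly (f j) (x (j - 1))) {x (j - 1)..x j}"
    using assms(3)
    by (intro fundamental_theorem_of_calculus)
       (auto intro!: has_field_derivative_at_within poly_DERIV
         simp flip: has_real_derivative_iff_has_vector_derivative)
  moreover have "degree (pderiv (f j)) \<le> d" using assms(2) by (simp add: degree_pderiv)
  ultimately show ?thesis
    using cell_average_quad[OF assms(1) _ assms(3), of "\<lambda>j. pderiv (f j)"] assms(3)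
    by (simp add: cell_average_def integral_unique cell_size_def field_simps)
qed

text \<open>The two terms with the average of \<open>w\<close> combine: exactness of the rule turns the sum of
  \<open>p\<^sub>x\<close> into the difference of the interior traces of the pressure, and the difference between
  an interface value \<open>p\<^sup>*\<close> and an interior trace is half a jump.\<close>

lemma source_decomposition:
  assumes "quad_exact N \<xi> \<omega> k" "degree (pe j) \<le> k" "x (j - 1) < x j" "j \<ge> 1"
  shows "cell_size x j * source x N \<xi> \<omega> \<rho>e pe w j
    = (\<Sum>\<mu> = 1..N. \<omega> \<mu> * (cell_size x j * poly (pderiv (pe j)) (cell_node x \<xi> j \<mu>)
          / poly (\<rho>e j) (cell_node x \<xi> j \<mu>) * poly (w j) (cell_node x \<xi> j \<mu>)))
      + (p_jump x pe j + p_jump x pe (j - 1)) / (2 * cell_average x \<rho>e j) * cell_average x w j"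
proof -
  define h where "h = cell_size x j"
  have h: "h > 0" using assms(3) by (simp add: h_def cell_size_def)
  define y where "y = cell_node x \<xi> j"
  define d where "d \<mu> = poly (pderiv (pe j)) (y \<mu>)" for \<mu>
  define A where "A = cell_average x w j / cell_average x \<rho>e j"
  have j: "j - 1 + 1 = j" using assms(4) by simp
  have D: "h * (\<Sum>\<mu> = 1..N. \<omega> \<mu> * d \<mu>) = poly (pe j) (x j) - poly (pe j) (x (j - 1))"
    using quad_pderiv[where f = pe and j = j, OF assms(1-3)] by (simp add: h_def d_def y_def)
  have jump: "p_star x pe j - p_star x pe (j - 1) - h * (\<Sum>\<mu> = 1..N. \<omega> \<mu> * d \<mu>)
      = (p_jump x pe j + p_jump x pe (j - 1)) / 2"
    unfolding D p_star_def p_jump_def j by (simp add: field_simps)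
  define Q where "Q = (p_star x pe j - p_star x pe (j - 1)) / h"
  have Q: "p_star x pe j - p_star x pe (j - 1) = h * Q" using h by (simp add: Q_def)
  have "h * source x N \<xi> \<omega> \<rho>e pe w j
      = (\<Sum>\<mu> = 1..N. \<omega> \<mu> * (h * d \<mu> / poly (\<rho>e j) (y \<mu>) * poly (w j) (y \<mu>)))
        + A * (p_star x pe j - p_star x pe (j - 1) - h * (\<Sum>\<mu> = 1..N. \<omega> \<mu> * d \<mu>))"
    unfolding Q source_def h_def[symmetric] y_def[symmetric] d_def[symmetric] A_def[symmetric] Q_def[symmetric]
    by (simp add: algebra_simps sum_distrib_left sum_subtractf)
  then show ?thesis
    unfolding jump by (simp add: h_def y_def d_def A_def mult.commute)
qed

lemma source_vector:
  assumes "quad_exact N \<xi> \<omega> k" "degree (pe j) \<le> k" "x (j - 1) < x j" "j \<ge> 1"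
  shows "cell_size x j *\<^sub>R vector [0, source x N \<xi> \<omega> \<rho>e pe (\<lambda>j. U j $ 1) j, source x N \<xi> \<omega> \<rho>e pe (\<lambda>j. U j $ 2) j]
    = (\<Sum>\<mu> = 1..N. \<omega> \<mu> *\<^sub>R forcing (cell_size x j * poly (pderiv (pe j)) (cell_node x \<xi> j \<mu>)
          / poly (\<rho>e j) (cell_node x \<xi> j \<mu>)) (state_at U j (cell_node x \<xi> j \<mu>)))
      + forcing ((p_jump x pe j + p_jump x pe (j - 1)) / (2 * cell_average x \<rho>e j)) (state_average x U j)"
  unfolding vec_eq_iff forall_3
  using source_decomposition[where pe = pe and j = j, OF assms, of \<rho>e "\<lambda>j. U j $ _"]
  by (simp add: vector_3 forcing_def state_at_def state_average_def)

lemma cell_node_Lobatto_ends: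
  assumes "gauss_lobatto_rule n \<xi> w"
  shows "cell_node x \<xi> j 1 = x (j - 1)" "cell_node x \<xi> j n = x j"
  using assms by (auto simp: gauss_lobatto_rule_def cell_node_def cell_size_def field_simps)

section \<open>Positivity of the updated cell average\<close>

text \<open>The budget of the update: the share \<open>\<alpha>F / w1\<close> of the average pays for the fluxes and
  the share \<open>\<alpha>S / w1\<close> for the source, both times \<open>dt / h\<close>; the CFL condition says that
  together they do not exceed the whole.  Here \<open>Ull, Ul\<close> and \<open>Ur, Urr\<close> are the outer and
  inner traces at the left, and the inner and outer traces at the right end of the cell.\<close>

lemma cell_update_admissible:
  assumes "\<gamma> > 1" "dt > 0" "h > 0" "w1 > 0"
    and average: "V \<in> admissible" "V = w1 *\<^sub>R (Ul + Ur) + R" "R \<in> closed_cone"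
    and traces: "Ul \<in> admissible" "Ur \<in> admissible" "Ull \<in> admissible" "Urr \<in> admissible"
    and scalings: "al > 0" "ar > 0" "all > 0" "arr > 0"
    and speed: "\<And>W. W \<in> {Ull, Ul, Ur, Urr} \<Longrightarrow> alpha_max \<gamma> W \<le> \<alpha>"
    and flux_speed: "\<alpha>F = 2 * max ar al * \<alpha>"
    and sources: "(\<alpha>S / w1) *\<^sub>R V + S \<in> closed_cone"
    and cfl: "(\<alpha>F + \<alpha>S) * dt \<le> w1 * h"
  shows "V + dt *\<^sub>R ((1 / h) *\<^sub>R (hllc_flux \<gamma> (all *\<^sub>R Ull) (al *\<^sub>R Ul)
      - hllc_flux \<gamma> (ar *\<^sub>R Ur) (arr *\<^sub>R Urr) + S)) \<in> admissible"
proof -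
  define Fl Fr where "Fl = hllc_flux \<gamma> (all *\<^sub>R Ull) (al *\<^sub>R Ul)"
    "Fr = hllc_flux \<gamma> (ar *\<^sub>R Ur) (arr *\<^sub>R Urr)"
  have \<alpha>: "\<alpha> \<ge> 0"
    using speed[of Ul] sound_speed_pos[OF assms(1) traces(1)] by (auto simp: alpha_max_def)
  have "\<alpha>F = 2 * \<alpha> * max ar al" by (simp add: flux_speed)
  then have \<alpha>F: "2 * \<alpha> * al \<le> \<alpha>F" "2 * \<alpha> * ar \<le> \<alpha>F"
    using \<alpha> by (auto intro!: mult_left_mono)
  then have \<alpha>F0: "\<alpha>F \<ge> 0" using \<alpha> scalings by (smt (verit) mult_nonneg_nonneg)
  have "(2 * \<alpha>) *\<^sub>R (ar *\<^sub>R Ur) - Fr \<in> admissible"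
    unfolding Fl_Fr_def using assms
    by (intro hllc_flux_one_sided admissible_scaleR) (auto simp: alpha_max_scaleR)
  then have right: "((2 * \<alpha>) *\<^sub>R (ar *\<^sub>R Ur) - Fr) + (\<alpha>F - 2 * \<alpha> * ar) *\<^sub>R Ur \<in> admissible"
    by (rule admissible_add) (use \<alpha>F traces in \<open>auto intro: closed_cone_scaleR admissible_imp_closed_cone\<close>)
  have "(2 * \<alpha>) *\<^sub>R (al *\<^sub>R Ul) + Fl \<in> admissible"
    unfolding Fl_Fr_def using assms
    by (intro hllc_flux_one_sided admissible_scaleR) (auto simp: alpha_max_scaleR)
  then have left: "((2 * \<alpha>) *\<^sub>R (al *\<^sub>R Ul) + Fl) + (\<alpha>F - 2 * \<alpha> * al) *\<^sub>R Ul \<in> admissible"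
    by (rule admissible_add) (use \<alpha>F traces in \<open>auto intro: closed_cone_scaleR admissible_imp_closed_cone\<close>)
  have rest: "(\<alpha>F / w1) *\<^sub>R R \<in> closed_cone"
    using \<alpha>F0 average(3) \<open>w1 > 0\<close> by (intro closed_cone_scaleR) auto
  note admissible_add[OF right admissible_imp_closed_cone[OF admissible_add[OF left rest]]]
  also have "(((2 * \<alpha>) *\<^sub>R (ar *\<^sub>R Ur) - Fr) + (\<alpha>F - 2 * \<alpha> * ar) *\<^sub>R Ur)
      + ((((2 * \<alpha>) *\<^sub>R (al *\<^sub>R Ul) + Fl) + (\<alpha>F - 2 * \<alpha> * al) *\<^sub>R Ul) + (\<alpha>F / w1) *\<^sub>R R)
      = (\<alpha>F / w1) *\<^sub>R V + Fl - Fr"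
    using \<open>w1 > 0\<close> unfolding average(2) by (simp add: algebra_simps)
  finally have fluxes: "(\<alpha>F / w1) *\<^sub>R V + Fl - Fr \<in> admissible" .
  \<comment> \<open>The share of the average that is left after fluxes and source.\<close>
  define r where "r = 1 - (\<alpha>F + \<alpha>S) * dt / (w1 * h)"
  have r: "r \<ge> 0" using cfl assms(3,4) by (simp add: r_def)
  have "(dt / h) *\<^sub>R ((\<alpha>F / w1) *\<^sub>R V + Fl - Fr) \<in> admissible"
    using assms(2,3) by (intro admissible_scaleR fluxes) simp
  moreover have "(dt / h) *\<^sub>R ((\<alpha>S / w1) *\<^sub>R V + S) \<in> closed_cone"
    using assms(2,3) by (intro closed_cone_scaleR sources) simp
  moreover have "r *\<^sub>R V \<in> closed_cone"
    using r average(1) by (intro closed_cone_scaleR admissible_imp_closed_cone)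
  ultimately have "(dt / h) *\<^sub>R ((\<alpha>F / w1) *\<^sub>R V + Fl - Fr)
      + ((dt / h) *\<^sub>R ((\<alpha>S / w1) *\<^sub>R V + S) + r *\<^sub>R V) \<in> admissible"
    by (rule admissible_add[OF _ closed_cone_add])
  also have "(dt / h) *\<^sub>R ((\<alpha>F / w1) *\<^sub>R V + Fl - Fr) + ((dt / h) *\<^sub>R ((\<alpha>S / w1) *\<^sub>R V + S) + r *\<^sub>R V)
     = (dt / h * (\<alpha>F / w1) + dt / h * (\<alpha>S / w1) + r) *\<^sub>R V + (dt / h) *\<^sub>R (Fl - Fr + S)"
    by (simp add: algebra_simps)
  also have "dt / h * (\<alpha>F / w1) + dt / h * (\<alpha>S / w1) + r = 1"
    using assms(3,4) by (simp add: r_def field_simps)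
  finally show ?thesis by (simp add: Fl_Fr_def)
qed

theorem theorem3p3:
  fixes \<gamma> dt :: real
    and M k N L :: nat
    and x :: "nat \<Rightarrow> real"
    and \<xi> \<omega> \<xi>' \<omega>' :: "nat \<Rightarrow> real"
    and \<phi> \<rho>ex uex pex :: "real \<Rightarrow> real"
    and W :: "(real \<Rightarrow> real) set"
    and P :: "(real \<Rightarrow> real) \<Rightarrow> nat \<Rightarrow> real poly"
    and \<rho>e pe :: "nat \<Rightarrow> real poly"
    and U :: "nat \<Rightarrow> real poly ^ 3"
  assumes "\<gamma> > 1" and "k \<ge> 1" and "dt > 0"
    and "mesh M x"
    and "gauss_rule N \<xi> \<omega>" and "quad_exact N \<xi> \<omega> k"
    and "gauss_lobatto_rule L \<xi>' \<omega>'" and "real L \<ge> (real k + 3) / 2"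
    (* the stationary solution and its projections *)
    and "hydrostatic {x 0<..<x M} \<phi> \<rho>ex uex pex"
    and "Vh_projection M x k W P" and "\<rho>ex \<in> W" and "pex \<in> W"
    and "\<forall>j\<in>{1..M}. \<rho>e j = P \<rho>ex j \<and> pe j = P pex j"
    (* positivity of the projections, and of the ghost values *)
    and "\<forall>j\<in>{1..M}. \<forall>y\<in>cell_points x L \<xi>' N \<xi> j. poly (\<rho>e j) y > 0 \<and> poly (pe j) y > 0"
    and "poly (\<rho>e 0) (x 0) > 0 \<and> poly (pe 0) (x 0) > 0"
    and "poly (\<rho>e (M + 1)) (x M) > 0 \<and> poly (pe (M + 1)) (x M) > 0"
    (* the numerical solution and its ghost values *)
    and "\<forall>i. (\<lambda>j. U j $ i) \<in> Vh M k"
    and "\<forall>j\<in>{1..M}. \<forall>y\<in>cell_points x L \<xi>' N \<xi> j. state_at U j y \<in> admissible"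
    and "state_at U 0 (x 0) \<in> admissible"
    and "state_at U (M + 1) (x M) \<in> admissible"
    (* the CFL condition *)
    and "\<forall>j\<in>{1..M}. cfl_alpha \<gamma> x N \<xi> (\<omega>' 1) \<rho>e pe U j * dt \<le> \<omega>' 1 * cell_size x j"
  shows "\<forall>j\<in>{1..M}. state_average x U j + dt *\<^sub>R dg_operator \<gamma> x N \<xi> \<omega> \<rho>e pe U j \<in> admissible"
proof
  fix j assume j: "j \<in> {1..M}"
  note gauss = assms(5) and exact = assms(6) and lobatto = assms(7)
  define h where "h = cell_size x j"
  define w1 where "w1 = \<omega>' 1"
  define V where "V = state_average x U j"
  define z where "z = cell_node x \<xi>' j"
  define y where "y = cell_node x \<xi> j"
  have j1: "j \<ge> 1" "j - 1 + 1 = j" using j by auto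
  have xj: "x (j - 1) < x j" using assms(4) j by (auto simp: mesh_def)
  then have h: "h > 0" by (simp add: h_def cell_size_def)
  have N: "{1..N} \<noteq> {}" using gauss by (auto simp: gauss_rule_def)
  have L: "L \<ge> 2" using lobatto by (auto simp: gauss_lobatto_rule_def)
  have w1: "w1 > 0" and wL: "\<omega>' L = w1"
    using gauss_lobatto_weight_pos[OF lobatto] gauss_lobatto_end_weights_eq[OF lobatto] L
    by (auto simp: w1_def)
  have lobatto_exact: "quad_exact L \<xi>' \<omega>' k"
    using lobatto assms(8) by (auto simp: gauss_lobatto_rule_def quad_exact_def)
  have degree: "degree (\<rho>e j) \<le> k" "degree (pe j) \<le> k" "degree (U j $ i) \<le> k" for i
    using assms(10-13,17) j by (auto simp: Vh_projection_def Vh_def)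
  have ends: "x l \<in> cell_points x L \<xi>' N \<xi> l" "x (l - 1) \<in> cell_points x L \<xi>' N \<xi> l" for l
  proof -
    have "cell_node x \<xi>' l L \<in> cell_points x L \<xi>' N \<xi> l" "cell_node x \<xi>' l 1 \<in> cell_points x L \<xi>' N \<xi> l"
      unfolding cell_points_def using L by (intro UnI1 imageI; simp)+
    then show "x l \<in> cell_points x L \<xi>' N \<xi> l" "x (l - 1) \<in> cell_points x L \<xi>' N \<xi> l"
      using cell_node_Lobatto_ends[OF lobatto, of x l] by simp_all
  qed
  have pe_pos: "poly (pe (j - 1)) (x (j - 1)) > 0" "poly (pe j) (x (j - 1)) > 0"
    "poly (pe j) (x j) > 0" "poly (pe (j + 1)) (x j) > 0"
  proof -
    show "poly (pe j) (x (j - 1)) > 0" "poly (pe j) (x j) > 0"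
      using assms(14) j ends[of j] by auto
    show "poly (pe (j - 1)) (x (j - 1)) > 0"
      using assms(15) bspec[OF assms(14), of "j - 1"] j ends(1)[of "j - 1"] by (cases "j = 1") force+
    show "poly (pe (j + 1)) (x j) > 0"
      using assms(16) bspec[OF assms(14), of "j + 1"] j ends(2)[of "j + 1"] by (cases "j = M") auto
  qed
  have traces: "state_at U (j - 1) (x (j - 1)) \<in> admissible" "state_at U j (x (j - 1)) \<in> admissible"
    "state_at U j (x j) \<in> admissible" "state_at U (j + 1) (x j) \<in> admissible"
  proof -
    show "state_at U j (x (j - 1)) \<in> admissible" "state_at U j (x j) \<in> admissible"
      using assms(18) j ends[of j] by auto
    show "state_at U (j - 1) (x (j - 1)) \<in> admissible"
      using assms(19) bspec[OF assms(18), of "j - 1"] j ends(1)[of "j - 1"] by (cases "j = 1") force+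
    show "state_at U (j + 1) (x j) \<in> admissible"
      using assms(20) bspec[OF assms(18), of "j + 1"] j ends(2)[of "j + 1"] by (cases "j = M") auto
  qed
  have star_pos: "p_star x pe j > 0" "p_star x pe (j - 1) > 0"
    using pe_pos j1 by (simp_all add: p_star_def)
  have gauss_nodes: "state_at U j (y \<mu>) \<in> admissible" "poly (\<rho>e j) (y \<mu>) > 0" if "\<mu> \<in> {1..N}" for \<mu>
    using assms(14,18) j that by (auto simp: cell_points_def y_def)
  have lobatto_nodes: "state_at U j (z \<nu>) \<in> admissible" if "\<nu> \<in> {1..L}" for \<nu>
    using assms(18) j that by (auto simp: cell_points_def z_def)
  have V_gauss: "V = (\<Sum>\<mu> = 1..N. \<omega> \<mu> *\<^sub>R state_at U j (y \<mu>))"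
    unfolding V_def y_def by (rule state_average_quad[where U = U and j = j, OF exact degree(3) xj])
  have V: "V \<in> admissible"
    unfolding V_gauss using N gauss_nodes gauss_weight_pos[OF gauss]
    by (intro admissible_sum admissible_scaleR) auto
  define R where "R = (\<Sum>\<nu>\<in>{1..L} - {1, L}. \<omega>' \<nu> *\<^sub>R state_at U j (z \<nu>))"
  have R: "R \<in> closed_cone"
    unfolding R_def using lobatto_nodes gauss_lobatto_weight_pos[OF lobatto]
    by (intro closed_cone_sum admissible_imp_closed_cone admissible_scaleR) auto
  have V_lobatto: "V = w1 *\<^sub>R (state_at U j (x (j - 1)) + state_at U j (x j)) + R"
  proof -
    have "V = (\<Sum>\<nu> = 1..L. \<omega>' \<nu> *\<^sub>R state_at U j (z \<nu>))"
      unfolding V_def z_def by (rule state_average_quad[where U = U and j = j, OF lobatto_exact degree(3) xj])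
    also have "\<dots> = R + (\<Sum>\<nu>\<in>{1, L}. \<omega>' \<nu> *\<^sub>R state_at U j (z \<nu>))"
      unfolding R_def using L by (intro sum.subset_diff) auto
    also have "(\<Sum>\<nu>\<in>{1, L}. \<omega>' \<nu> *\<^sub>R state_at U j (z \<nu>))
        = w1 *\<^sub>R (state_at U j (x (j - 1)) + state_at U j (x j))"
      using L cell_node_Lobatto_ends[OF lobatto, of x j]
      by (simp add: wL w1_def z_def scaleR_add_right)
    finally show ?thesis by simp
  qed
  have \<rho>avg: "cell_average x \<rho>e j > 0"
    unfolding cell_average_quad[where f = \<rho>e and j = j, OF exact degree(1) xj] y_def[symmetric]
    using N gauss_nodes gauss_weight_pos[OF gauss] by (intro sum_pos mult_pos_pos) auto

  \<comment> \<open>The strengths of the forces at the Gauss nodes and on the average, and the multiples of the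
    states that the CFL quantity provides against them.\<close>
  define \<beta> where "\<beta> \<mu> = h * poly (pderiv (pe j)) (y \<mu>) / poly (\<rho>e j) (y \<mu>)" for \<mu>
  define \<beta>' where "\<beta>' = (p_jump x pe j + p_jump x pe (j - 1)) / (2 * cell_average x \<rho>e j)"
  define \<kappa> where "\<kappa> = cfl_source x N \<xi> w1 \<rho>e pe U j / w1"
  define \<kappa>' where "\<kappa>' = cfl_source_average x w1 \<rho>e pe U j / w1"
  define S where "S = (\<Sum>\<mu> = 1..N. \<omega> \<mu> *\<^sub>R forcing (\<beta> \<mu>) (state_at U j (y \<mu>))) + forcing \<beta>' V"
  have node_source: "\<kappa> *\<^sub>R state_at U j (y \<mu>) + forcing (\<beta> \<mu>) (state_at U j (y \<mu>)) \<in> closed_cone"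
    if \<mu>: "\<mu> \<in> {1..N}" for \<mu>
  proof (rule forcing_closed_cone[OF gauss_nodes(1)[OF \<mu>]])
    have e: "sqrt (2 * internal_energy (state_at U j (y \<mu>))) > 0"
      using internal_energy_pos[OF gauss_nodes(1)[OF \<mu>]] by simp
    have "\<bar>poly (pderiv (pe j)) (y \<mu>)\<bar> / (poly (\<rho>e j) (y \<mu>) * sqrt (2 * internal_energy (state_at U j (y \<mu>))))
        \<le> \<kappa> / h"
      using w1 h \<mu> unfolding \<kappa>_def cfl_source_def h_def[symmetric] y_def[symmetric]
      by (auto intro!: Max_ge)
    then show "\<bar>\<beta> \<mu>\<bar> \<le> \<kappa> * sqrt (2 * internal_energy (state_at U j (y \<mu>)))"
      using e h gauss_nodes(2)[OF \<mu>] by (simp add: \<beta>_def abs_mult field_simps)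
  qed
  have average_source: "\<kappa>' *\<^sub>R V + forcing \<beta>' V \<in> closed_cone"
  proof (rule forcing_closed_cone[OF V])
    show "\<bar>\<beta>'\<bar> \<le> \<kappa>' * sqrt (2 * internal_energy V)"
      using w1 \<rho>avg internal_energy_pos[OF V]
      unfolding \<kappa>'_def cfl_source_average_def V_def[symmetric] \<beta>'_def
      by (simp add: abs_mult)
  qed
  have "(\<Sum>\<mu> = 1..N. \<omega> \<mu> *\<^sub>R (\<kappa> *\<^sub>R state_at U j (y \<mu>) + forcing (\<beta> \<mu>) (state_at U j (y \<mu>))))
      \<in> closed_cone"
    by (rule closed_cone_sum, rule closed_cone_scaleR[OF node_source])
       (use gauss_weight_pos[OF gauss] in \<open>auto simp: less_imp_le\<close>)
  note closed_cone_add[OF this average_source]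
  also have "(\<Sum>\<mu> = 1..N. \<omega> \<mu> *\<^sub>R (\<kappa> *\<^sub>R state_at U j (y \<mu>) + forcing (\<beta> \<mu>) (state_at U j (y \<mu>))))
      = \<kappa> *\<^sub>R V + (\<Sum>\<mu> = 1..N. \<omega> \<mu> *\<^sub>R forcing (\<beta> \<mu>) (state_at U j (y \<mu>)))"
    unfolding V_gauss by (simp add: scaleR_add_right sum.distrib scaleR_sum_right mult.commute)
  finally have sources: "((cfl_source x N \<xi> w1 \<rho>e pe U j + cfl_source_average x w1 \<rho>e pe U j) / w1) *\<^sub>R V + S \<in> closed_cone"
    by (simp add: S_def \<kappa>_def \<kappa>'_def add_divide_distrib scaleR_add_left add_ac)

  define \<alpha> where "\<alpha> = Max (alpha_max \<gamma> ` {state_at U (j - 1) (x (j - 1)), state_at U j (x (j - 1)),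
            state_at U j (x j), state_at U (j + 1) (x j)})"
  have update: "V + dt *\<^sub>R ((1 / h) *\<^sub>R (
        hllc_flux \<gamma> ((p_star x pe (j - 1) / poly (pe (j - 1)) (x (j - 1))) *\<^sub>R state_at U (j - 1) (x (j - 1)))
          ((p_star x pe (j - 1) / poly (pe j) (x (j - 1))) *\<^sub>R state_at U j (x (j - 1)))
      - hllc_flux \<gamma> ((p_star x pe j / poly (pe j) (x j)) *\<^sub>R state_at U j (x j))
          ((p_star x pe j / poly (pe (j + 1)) (x j)) *\<^sub>R state_at U (j + 1) (x j)) + S)) \<in> admissible"
  proof (rule cell_update_admissible[OF assms(1,3) h w1 V V_lobatto R traces(2,3,1,4) _ _ _ _ _ _ sources])
    show "alpha_max \<gamma> W \<le> \<alpha>" if "W \<in> {state_at U (j - 1) (x (j - 1)), state_at U j (x (j - 1)),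
            state_at U j (x j), state_at U (j + 1) (x j)}" for W
      unfolding \<alpha>_def using that by (intro Max_ge) blast+
    show "cfl_flux \<gamma> x pe U j = 2 * max (p_star x pe j / poly (pe j) (x j))
        (p_star x pe (j - 1) / poly (pe j) (x (j - 1))) * \<alpha>"
      by (simp only: cfl_flux_def \<alpha>_def)
    show "(cfl_flux \<gamma> x pe U j + (cfl_source x N \<xi> w1 \<rho>e pe U j + cfl_source_average x w1 \<rho>e pe U j)) * dt \<le> w1 * h"
      using assms(21) j by (simp add: cfl_alpha_def w1_def h_def add_ac)
  qed (use star_pos pe_pos in auto)
  have source: "vector [0, source x N \<xi> \<omega> \<rho>e pe (\<lambda>j. U j $ 1) j, source x N \<xi> \<omega> \<rho>e pe (\<lambda>j. U j $ 2) j]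
      = (1 / h) *\<^sub>R S" (is "?s = _")
  proof -
    have "h *\<^sub>R ?s = S"
      using source_vector[where pe = pe and j = j and \<rho>e = \<rho>e and U = U, OF exact degree(2) xj j1(1)]
      unfolding S_def \<beta>_def \<beta>'_def V_def h_def y_def .
    then have "S = h *\<^sub>R ?s" ..
    then show ?thesis using h by simp
  qed
  show "state_average x U j + dt *\<^sub>R dg_operator \<gamma> x N \<xi> \<omega> \<rho>e pe U j \<in> admissible"
    using update
    unfolding dg_operator_def source numerical_flux_def j1(2) h_def[symmetric] V_def[symmetric]
    by (simp add: algebra_simps)
qed

end
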